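(* Let $(\alpha,\beta,\gamma),(\overline{\alpha},\overline{\beta},\overline{\gamma})\in\mathbb{R}^3$ with $\beta,\overline{\beta}\notin\{0,3\}$, and suppose that the cubic parabolas $c_{\alpha,\beta,\gamma}$ and $c_{\overline{\alpha},\overline{\beta},\overline{\gamma}}$ on Cayley's ruled surface $F$ are distinct. Then $c_{\alpha,\beta,\gamma}$ and $c_{\overline{\alpha},\overline{\beta},\overline{\gamma}}$ have (a) second order contact at $U$ if, and only if, $\beta=\overline{\beta}$ or $\beta=3-\overline{\beta}$; (b) third order contact at $U$ if, and only if, ($\beta=\overline{\beta}$ and $\gamma=\overline{\gamma}$) or $\beta=\overline{\beta}=\frac32$; (c) fourth order contact at $U$ if, and only if, $\beta=\overline{\beta}=\frac32$ and $\gamma=\overline{\gamma}$.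
   Context: We work in the real projective space $\mathbb{P}_3(\mathbb{R})$; its points are $\mathbb{R}\mathbf{x}$ with $\mathbf{x}=(x_0,x_1,x_2,x_3)^{\mathrm T}\in\mathbb{R}^{4\times 1}$ non-zero. Cayley's (ruled cubic) surface is the surface $F$ with equation $3x_0x_1x_2-x_1^3-3x_3x_0^2=0$. Put $U=\mathbb{R}(0,0,0,1)^{\mathrm T}$. For $(\alpha,\beta,\gamma)\in\mathbb{R}^3$ with $\beta\neq 0$ define $\Phi_{\alpha,\beta,\gamma}:\mathbb{R}^{2\times 1}\to\mathbb{R}^{4\times 1}$ by $$\Phi_{\alpha,\beta,\gamma}\big((u_0,u_1)^{\mathrm T}\big)=\Big(u_0^3,\ u_0^2(u_1-\gamma u_0),\ \frac{u_0(u_1^2+\alpha u_0^2)}{\beta},\ \frac{u_1-\gamma u_0}{3\beta}\big(3(u_1^2+\alpha u_0^2)-\beta(u_1-\gamma u_0)^2\big)\Big)^{\mathrm T}.$$ If moreover $\beta\neq 3$, the map $\mathbb{P}_1(\mathbb{R})\to\mathbb{P}_3(\mathbb{R})$, $\mathbb{R}\mathbf{u}\mapsto\mathbb{R}\,\Phi_{\alpha,\beta,\gamma}(\mathbf{u})$ is well defined, and its image is denoted by $c_{\alpha,\beta,\gamma}$; it is a twisted cubic (cubic parabola) contained in $F$. The point $U$ lies on every $c_{\alpha,\beta,\gamma}$ (it is the image of $\mathbb{R}(0,1)^{\mathrm T}$). Contact of order $k$ of two curves at a common point means contact of order at least $k$: in an affine chart around the point, the two curves admit regular local parametrizations whose Taylor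 expansions at the point agree up to and including terms of degree $k$. *)

theory Defs
  imports "HOL-Analysis.Analysis"
begin

text \<open>
  Points of a real projective space are represented as the one-dimensional subspaces
  \<open>span {x}\<close> with \<open>x \<noteq> 0\<close>. Homogeneous coordinates are counted from \<open>1\<close>: the coordinates
  \<open>(x\<^sub>0, x\<^sub>1, x\<^sub>2, x\<^sub>3)\<close> of the mathematical text are \<open>x$1, x$2, x$3, x$4\<close>, and \<open>(u\<^sub>0, u\<^sub>1)\<close> are
  \<open>u$1, u$2\<close>.
\<close>

definition cayley_surface :: "(real^4) set set" where
  "cayley_surface =
     {span {x} | x. x \<noteq> 0 \<and> 3 * x$1 * x$2 * x$3 - (x$2)^3 - 3 * x$4 * (x$1)^2 = 0}"

definition point_U :: "(real^4) set" where
  "point_U = span {vector [0, 0, 0, 1]}"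

definition Phi :: "real \<Rightarrow> real \<Rightarrow> real \<Rightarrow> real^2 \<Rightarrow> real^4" where
  "Phi \<alpha> \<beta> \<gamma> u = vector
     [(u$1)^3,
      (u$1)^2 * (u$2 - \<gamma> * u$1),
      u$1 * ((u$2)^2 + \<alpha> * (u$1)^2) / \<beta>,
      (u$2 - \<gamma> * u$1) / (3 * \<beta>) *
        (3 * ((u$2)^2 + \<alpha> * (u$1)^2) - \<beta> * (u$2 - \<gamma> * u$1)^2)]"

definition cubic_parabola :: "real \<Rightarrow> real \<Rightarrow> real \<Rightarrow> (real^4) set set" where
  "cubic_parabola \<alpha> \<beta> \<gamma> = {span {Phi \<alpha> \<beta> \<gamma> u} | u. u \<noteq> 0}"

definition iter_vderiv :: "nat \<Rightarrow> (real \<Rightarrow> 'a::real_normed_vector) \<Rightarrow> real \<Rightarrow> 'a" where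
  "iter_vderiv n g = ((\<lambda>h t. vector_derivative h (at t)) ^^ n) g"

definition smooth_on :: "real set \<Rightarrow> (real \<Rightarrow> 'a::real_normed_vector) \<Rightarrow> bool" where
  "smooth_on I g \<longleftrightarrow> (\<forall>n. \<forall>t\<in>I. iter_vderiv n g differentiable (at t))"

definition taylor_coeff :: "(real \<Rightarrow> 'a::real_normed_vector) \<Rightarrow> nat \<Rightarrow> 'a" where
  "taylor_coeff g n = iter_vderiv n g 0 /\<^sub>R fact n"

text \<open>
  A linear bijection \<open>L\<close> from \<open>real \<times> (real^3)\<close> onto \<open>real^4\<close> determines the affine chart whose
  inverse is \<open>y \<mapsto> span {L (1, y)}\<close>; its domain is the complement of the plane
  \<open>{L (0, y) | y. True}\<close>. All affine charts arise in this way.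
\<close>

definition affine_chart :: "(real \<times> (real^3) \<Rightarrow> real^4) \<Rightarrow> bool" where
  "affine_chart L \<longleftrightarrow> linear L \<and> bij L"

definition in_chart ::
    "(real \<times> (real^3) \<Rightarrow> real^4) \<Rightarrow> (real^4) set set \<Rightarrow> (real^3) set" where
  "in_chart L C = {y. span {L (1, y)} \<in> C}"

text \<open>
  A regular local parametrization of \<open>C\<close> at the point \<open>P\<close>, written in the chart \<open>L\<close> and with \<open>P\<close>
  at parameter \<open>0\<close>: a smooth immersion of an open interval that is a homeomorphism onto a
  neighbourhood of \<open>P\<close> in \<open>C\<close>. Openness of the image is what excludes, for instance,
  parametrizing just a part of \<open>C\<close> that ends in \<open>P\<close> or one of several branches through \<open>P\<close>.
\<close>

definition regular_local_param ::
    "(real \<times> (real^3) \<Rightarrow> real^4) \<Rightarrow> (real^4) set set \<Rightarrow> (real^4) set \<Rightarrow> (real \<Rightarrow> real^3) \<Rightarrow> bool"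
  where
  "regular_local_param L C P g \<longleftrightarrow>
     span {L (1, g 0)} = P \<and>
     (\<exists>e>0. let I = {-e<..<e} in
        smooth_on I g \<and>
        (\<forall>t\<in>I. vector_derivative g (at t) \<noteq> 0) \<and>
        openin (top_of_set (in_chart L C)) (g ` I) \<and>
        (\<exists>h. homeomorphism I (g ` I) g h))"

text \<open>Contact of order \<open>k\<close> means contact of order at least \<open>k\<close>.\<close>

definition contact ::
    "nat \<Rightarrow> (real^4) set set \<Rightarrow> (real^4) set set \<Rightarrow> (real^4) set \<Rightarrow> bool" where
  "contact k C D P \<longleftrightarrow>
     (\<exists>L g h. affine_chart L \<and> regular_local_param L C P g \<and> regular_local_param L D P h \<and>
        (\<forall>i\<le>k. taylor_coeff g i = taylor_coeff h i))"

lemma vector_nth_4 [simp]: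
  "(vector [a, b, c, d] :: 'a::zero^4) $ 1 = a"
  "(vector [a, b, c, d] :: 'a^4) $ 2 = b"
  "(vector [a, b, c, d] :: 'a^4) $ 3 = c"
  "(vector [a, b, c, d] :: 'a^4) $ 4 = d"
  by (simp_all add: vector_def)

text \<open>The map induced by \<open>Phi\<close> on projective points is well defined.\<close>

lemma Phi_nonzero:
  assumes "\<beta> \<noteq> 0" "\<beta> \<noteq> 3" "u \<noteq> 0"
  shows "Phi \<alpha> \<beta> \<gamma> u \<noteq> 0"
proof
  assume *: "Phi \<alpha> \<beta> \<gamma> u = 0"
  then have "Phi \<alpha> \<beta> \<gamma> u $ 1 = 0" "Phi \<alpha> \<beta> \<gamma> u $ 4 = 0" by simp_all
  then have 1: "u$1 = 0" and "u$2 * (3 * (u$2)^2 - \<beta> * (u$2)^2) = 0"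
    using assms(1) by (auto simp: Phi_def)
  then have "(3 - \<beta>) * (u$2)^3 = 0"
    by (simp add: algebra_simps power2_eq_square power3_eq_cube)
  then have "u$2 = 0" using assms(2) by simp
  with 1 assms(3) show False by (simp add: vec_eq_iff forall_2)
qed

lemma Phi_scaleR: "Phi \<alpha> \<beta> \<gamma> (r *\<^sub>R u) = r^3 *\<^sub>R Phi \<alpha> \<beta> \<gamma> u"
  by (simp add: vec_eq_iff forall_4 Phi_def field_simps power2_eq_square power3_eq_cube)

lemma cubic_parabola_subset_cayley_surface:
  assumes "\<beta> \<noteq> 0" "\<beta> \<noteq> 3"
  shows "cubic_parabola \<alpha> \<beta> \<gamma> \<subseteq> cayley_surface"
proof -
  have "3 * x$1 * x$2 * x$3 - (x$2)^3 - 3 * x$4 * (x$1)^2 = 0" if "x = Phi \<alpha> \<beta> \<gamma> u" for x u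
    using assms(1) unfolding that
    by (simp add: Phi_def field_simps power2_eq_square power3_eq_cube)
  then show ?thesis
    unfolding cubic_parabola_def cayley_surface_def using Phi_nonzero[OF assms] by blast
qed

lemma point_U_in_cubic_parabola:
  assumes "\<beta> \<noteq> 0" "\<beta> \<noteq> 3"
  shows "point_U \<in> cubic_parabola \<alpha> \<beta> \<gamma>"
proof -
  let ?u = "vector [0, 1] :: real^2"
  have "Phi \<alpha> \<beta> \<gamma> ?u = ((3 - \<beta>) / (3 * \<beta>)) *\<^sub>R vector [0, 0, 0, 1]"
    by (simp add: vec_eq_iff forall_4 Phi_def)
  then have "span {Phi \<alpha> \<beta> \<gamma> ?u} = point_U"
    unfolding point_U_def
    using span_image_scale[of "{vector [0, 0, 0, 1] :: real^4}" "\<lambda>_. (3 - \<beta>) / (3 * \<beta>)"] assms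
    by simp
  moreover have "?u \<noteq> 0" by (simp add: vec_eq_iff forall_2)
  ultimately show ?thesis unfolding cubic_parabola_def by blast
qed

end

theory Submission
  imports Defs "HOL-Library.Landau_Symbols" "HOL-Computational_Algebra.Polynomial"
begin

text \<open>
  Write \<open>x\<^sub>0, \<dots>, x\<^sub>3\<close> for the homogeneous coordinates and \<open>s = u\<^sub>0/u\<^sub>1\<close>. Near \<open>U\<close>, which is \<open>s = 0\<close>, the curve
  is \<open>s \<mapsto> \<real> \<Phi>(s, 1)\<close>, its last coordinate is \<open>w(s)/\<beta>\<close> for a cubic polynomial \<open>w\<close> with
  \<open>w(0) = (3 - \<beta>)/3 \<noteq> 0\<close>, and the quotients by the last coordinate are
  \<open>z = x\<^sub>2/x\<^sub>3 = (s + \<alpha>s^3)/w(s)\<close>, \<open>x\<^sub>1/x\<^sub>3 = \<beta>s^2(1 - \<gamma>s)/w(s)\<close> and \<open>x\<^sub>0/x\<^sub>3 = \<beta>s^3/w(s)\<close>.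
  As \<open>z\<close> vanishes to first order at \<open>s = 0\<close>, it can serve as the local parameter, and then
  \<open>x\<^sub>1/x\<^sub>3 = a\<^sub>2z^2 + a\<^sub>3z^3 + a\<^sub>4z^4 + O(z^5)\<close> and \<open>x\<^sub>0/x\<^sub>3 = b\<^sub>3z^3 + b\<^sub>4z^4 + O(z^5)\<close>
  (\<open>jet_expansion\<close>). Two such curves have contact of order \<open>k \<le> 4\<close> at \<open>U\<close> exactly when these coefficients
  agree up to index \<open>k\<close> (\<open>contact_iff_jets_eq\<close>), and the theorem is read off from them
  (\<open>jets_eq_iff\<close>). With \<open>m = (3 - \<beta>)/3\<close>: \<open>a\<^sub>2 = \<beta>m\<close> takes each value exactly at some \<open>\<beta>\<close> and \<open>3 - \<beta>\<close>, which is (a);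
  \<open>b\<^sub>3 = \<beta>m^2\<close> separates these two values, and \<open>a\<^sub>3 = \<beta>m(4\<beta> - 6)\<gamma>/3\<close> determines \<open>\<gamma>\<close> unless \<open>\<beta> = 3/2\<close>,
  which is (b); \<open>b\<^sub>4 = 2\<beta>(\<beta> - 1)m^2\<gamma>\<close> determines \<open>\<gamma>\<close> also for \<open>\<beta> = 3/2\<close>, and \<open>\<alpha>\<close> enters \<open>a\<^sub>4\<close> through
  \<open>\<beta>m^2(2\<beta> - 3)\<alpha>/3\<close>, so that for distinct curves only \<open>\<beta> = 3/2\<close> is left, which is (c).
  
  The definition of contact quantifies over charts and parametrizations. Smoothness turns equality of
  Taylor coefficients up to order \<open>k\<close> into \<open>g - h = o(t^k)\<close> (\<open>taylor_coeffs_eq_iff_smallo\<close>). The quotients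
  \<open>x\<^sub>i/x\<^sub>3\<close> do not depend on the chart, so this estimate passes to them; and whatever the
  regular parametrization is, they obey the two expansions above with \<open>z\<close> of exact order \<open>t\<close>
  (\<open>regular_local_param_at_U\<close>). Hence contact forces the coefficients to agree
  (\<open>smallo_diff_iff_coeff_eq\<close>). For the converse it is enough to have, on each curve, a regular
  parametrization with \<open>z = t + O(t^5)\<close> (\<open>exists_regular_local_param_at_U\<close>).
\<close>

section \<open>Asymptotics in powers of a local parameter\<close>

lemma bigo_power_mult:
  fixes f g z :: "real \<Rightarrow> real"
  assumes "f \<in> O[F](\<lambda>t. z t ^ m)" "g \<in> O[F](\<lambda>t. z t ^ n)"
  shows "(\<lambda>t. f t * g t) \<in> O[F](\<lambda>t. z t ^ (m + n))"
  using landau_o.big.mult[OF assms] by (simp add: power_add)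

lemma bigo_power_mono:
  fixes f z :: "real \<Rightarrow> real"
  assumes "(z \<longlongrightarrow> 0) F" "m \<le> n" "f \<in> O[F](\<lambda>t. z t ^ n)"
  shows "f \<in> O[F](\<lambda>t. z t ^ m)"
proof -
  have "((\<lambda>t. \<bar>z t\<bar>) \<longlongrightarrow> 0) F" using tendsto_rabs[OF assms(1)] by simp
  then have "\<forall>\<^sub>F t in F. \<bar>z t\<bar> < 1" by (rule order_tendstoD) simp
  then have "\<forall>\<^sub>F t in F. norm (z t ^ n) \<le> 1 * norm (z t ^ m)"
  proof eventually_elim
    case (elim t)
    then show ?case using assms(2) by (simp add: power_abs power_decreasing)
  qed
  then have "(\<lambda>t. z t ^ n) \<in> O[F](\<lambda>t. z t ^ m)" by (rule bigoI)
  with assms(3) show ?thesis by (rule landau_o.big_trans)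
qed

text \<open>
  Gets rid of the unit factors, such as \<open>1 + \<alpha>s^2\<close>, that remain when a rational function of \<open>s\<close> is written
  as a polynomial relation.
\<close>

lemma bigo_if_mult_tendsto_1:
  fixes u v E :: "'a \<Rightarrow> real"
  assumes "(E \<longlongrightarrow> 1) F" "\<forall>\<^sub>F t in F. u t * E t = v t" "v \<in> O[F](h)"
  shows "u \<in> O[F](h)"
proof -
  have "\<forall>\<^sub>F t in F. E t > 1 / 2" using assms(1) by (rule order_tendstoD) simp
  with assms(2) have "\<forall>\<^sub>F t in F. norm (u t) \<le> 2 * norm (v t)"
  proof eventually_elim
    case (elim t)
    have "norm (u t) * (1 / 2) \<le> norm (u t) * E t" using elim(2) by (intro mult_left_mono) auto
    also have "\<dots> = norm (v t)" using elim by (simp add: abs_mult flip: elim(1))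
    finally show ?case by simp
  qed
  then have "u \<in> O[F](v)" by (rule bigoI)
  with assms(3) show ?thesis using landau_o.big_trans by blast
qed

lemma cmult_in_bigoI: "f \<in> O[F](g) \<Longrightarrow> (\<lambda>t. c * f t) \<in> O[F](g)" for c :: real
  by simp

lemma bigo_power_diff_of_square_cube:
  fixes s w :: "real \<Rightarrow> real"
  assumes "s \<in> O[F](\<lambda>t. z t ^ 1)" "w \<in> O[F](\<lambda>t. z t ^ 1)"
    and "(\<lambda>t. s t - w t) \<in> O[F](\<lambda>t. z t ^ n)"
  shows "(\<lambda>t. s t ^ 2 - w t ^ 2) \<in> O[F](\<lambda>t. z t ^ (n + 1))"
    and "(\<lambda>t. s t ^ 3 - w t ^ 3) \<in> O[F](\<lambda>t. z t ^ (n + 2))"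
proof -
  have "(\<lambda>t. s t ^ 2 - w t ^ 2) = (\<lambda>t. (s t - w t) * (s t + w t))"
    by (simp add: algebra_simps power2_eq_square)
  moreover have "(\<lambda>t. s t + w t) \<in> O[F](\<lambda>t. z t ^ 1)" using assms by (intro sum_in_bigo)
  ultimately show "(\<lambda>t. s t ^ 2 - w t ^ 2) \<in> O[F](\<lambda>t. z t ^ (n + 1))"
    using bigo_power_mult[OF assms(3), of "\<lambda>t. s t + w t" 1] by (simp only:)
  have "(\<lambda>t. s t ^ 3 - w t ^ 3) = (\<lambda>t. (s t - w t) * (s t * s t + s t * w t + w t * w t))"
    by (simp add: algebra_simps power3_eq_cube)
  moreover have "(\<lambda>t. s t * s t + s t * w t + w t * w t) \<in> O[F](\<lambda>t. z t ^ (1 + 1))"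
    using assms by (intro sum_in_bigo bigo_power_mult)
  ultimately show "(\<lambda>t. s t ^ 3 - w t ^ 3) \<in> O[F](\<lambda>t. z t ^ (n + 2))"
    using bigo_power_mult[OF assms(3), of "\<lambda>t. s t * s t + s t * w t + w t * w t" "1 + 1"]
    by (simp only: one_add_one)
qed

text \<open>
  The lowest term of \<open>p\<close> dominates as \<open>t\<close> tends to \<open>0\<close>, and \<open>z\<close> behaves like \<open>t\<close>, so no cancellation can make
  \<open>p(z)\<close> smaller than that term.
\<close>

lemma poly_smallo_power_iff:
  fixes z :: "real \<Rightarrow> real"
  assumes z: "z \<in> \<Theta>[at 0](\<lambda>t. t)"
  shows "(\<lambda>t. poly p (z t)) \<in> o[at 0](\<lambda>t. t ^ k) \<longleftrightarrow> (\<forall>i\<le>k. coeff p i = 0)"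
proof (induction p arbitrary: k)
  case 0
  then show ?case by simp
next
  case (pCons a p)
  have "z \<in> O[at 0](\<lambda>t. t)" using z by blast
  moreover have "(\<lambda>t. t) \<in> o[at 0](\<lambda>t. 1 :: real)" by (rule smalloI_tendsto) (auto intro!: tendsto_eq_intros)
  ultimately have "z \<in> o[at 0](\<lambda>_. 1)" by (rule landau_o.big_small_trans)
  then have z0: "(z \<longlongrightarrow> 0) (at 0)" by (auto dest: smalloD_tendsto)
  have lim: "((\<lambda>t. a + z t * poly p (z t)) \<longlongrightarrow> a) (at 0)"
    using z0 by (auto intro!: tendsto_eq_intros)
  have nz: "\<forall>\<^sub>F t in at 0. (t :: real) \<noteq> 0" by (simp add: eventually_at_filter)
  have a0: "a = 0" if "(\<lambda>t. a + z t * poly p (z t)) \<in> o[at 0](\<lambda>t. t ^ k)"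
  proof -
    have "(\<lambda>t. t ^ k) \<in> O[at 0](\<lambda>t. 1 :: real)"
      by (rule bigoI_tendsto[of _ _ "0 ^ k"]) (auto intro!: tendsto_eq_intros)
    with that have "(\<lambda>t. a + z t * poly p (z t)) \<in> o[at 0](\<lambda>t. 1)" by (rule landau_o.small_big_trans)
    then have "((\<lambda>t. a + z t * poly p (z t)) \<longlongrightarrow> 0) (at 0)" by (auto dest: smalloD_tendsto)
    with lim show "a = 0" using tendsto_unique by (metis trivial_limit_at)
  qed
  show ?case
  proof (cases k)
    case 0
    then show ?thesis using a0 lim by (auto intro!: smalloI_tendsto)
  next
    case (Suc j)
    have "(\<lambda>t. z t * poly p (z t)) \<in> o[at 0](\<lambda>t. t ^ k) \<longleftrightarrow> (\<lambda>t. t * poly p (z t)) \<in> o[at 0](\<lambda>t. t ^ k)"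
      using z by (intro landau_o.small.in_cong_bigtheta landau_theta.mult_right)
    also have "\<dots> \<longleftrightarrow> (\<lambda>t. poly p (z t)) \<in> o[at 0](\<lambda>t. t ^ j)"
      using landau_o.small.divide_right_iff[of "\<lambda>t. t" "at 0" "\<lambda>t. t * poly p (z t)" "\<lambda>t. t ^ k"] nz Suc
      by (subst landau_o.small.mult_cancel_left[of "\<lambda>t. t", symmetric]) (auto simp: landau_o.small.mult_cancel_left)
    finally show ?thesis
      using a0 pCons.IH[of j] unfolding Suc by (auto simp: less_Suc_eq_le All_less_Suc2 coeff_pCons split: nat.splits)
  qed
qed

lemma poly_diff_bigo:
  fixes y z :: "real \<Rightarrow> real"
  assumes "y \<in> O[F](\<lambda>_. 1)" "z \<in> O[F](\<lambda>_. 1)"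
  shows "(\<lambda>t. poly p (y t) - poly p (z t)) \<in> O[F](\<lambda>t. y t - z t)"
proof (induction p)
  case 0
  then show ?case by simp
next
  case (pCons a p)
  have b: "(\<lambda>t. poly p (y t)) \<in> O[F](\<lambda>_. 1)"
    by (induction p) (auto intro!: sum_in_bigo landau_o.big.mult_in_1 assms)
  have "(\<lambda>t. (y t - z t) * poly p (y t)) \<in> O[F](\<lambda>t. (y t - z t) * 1)"
    using b by (rule landau_o.big.mult_left)
  moreover have "(\<lambda>t. z t * (poly p (y t) - poly p (z t))) \<in> O[F](\<lambda>t. 1 * (y t - z t))"
    using assms(2) pCons.IH by (rule landau_o.big.mult)
  ultimately have "(\<lambda>t. (y t - z t) * poly p (y t) + z t * (poly p (y t) - poly p (z t)))
    \<in> O[F](\<lambda>t. y t - z t)" by (intro sum_in_bigo) simp_all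
  then show ?case by (simp add: algebra_simps)
qed

text \<open>
  Comparison of two functions that are expanded in two different parameters \<open>z\<close> and \<open>y\<close>. The parameters may be
  exchanged, since polynomials are Lipschitz on bounded sets and therefore \<open>q(z) - q(y)\<close> is as small as
  \<open>z - y\<close>; what remains is \<open>p - q\<close> evaluated at \<open>z\<close>.
\<close>

lemma smallo_diff_iff_coeff_eq:
  fixes A B y z :: "real \<Rightarrow> real"
  assumes z: "z \<in> \<Theta>[at 0](\<lambda>t. t)" and y: "y \<in> \<Theta>[at 0](\<lambda>t. t)"
    and zy: "(\<lambda>t. z t - y t) \<in> o[at 0](\<lambda>t. t ^ k)"
    and A: "(\<lambda>t. A t - poly p (z t)) \<in> o[at 0](\<lambda>t. t ^ k)"
    and B: "(\<lambda>t. B t - poly q (y t)) \<in> o[at 0](\<lambda>t. t ^ k)"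
  shows "(\<lambda>t. A t - B t) \<in> o[at 0](\<lambda>t. t ^ k) \<longleftrightarrow> (\<forall>i\<le>k. coeff p i = coeff q i)"
proof -
  have t1: "(\<lambda>t. t) \<in> O[at 0](\<lambda>_. 1 :: real)"
    by (rule bigoI_tendsto[of _ _ 0]) (auto intro!: tendsto_eq_intros)
  have "z \<in> O[at 0](\<lambda>_. 1)" "y \<in> O[at 0](\<lambda>_. 1)"
    using z y t1 landau_o.big_trans by blast+
  then have "(\<lambda>t. poly q (z t) - poly q (y t)) \<in> o[at 0](\<lambda>t. t ^ k)"
    using zy by (blast intro: landau_o.big_small_trans poly_diff_bigo)
  then have rest: "(\<lambda>t. (A t - poly p (z t)) - (B t - poly q (y t)) + (poly q (z t) - poly q (y t))) \<in> o[at 0](\<lambda>t. t ^ k)"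
    (is "?r \<in> _")
    using sum_in_smallo(1)[OF sum_in_smallo(2)[OF A B]] by blast
  have "(\<lambda>t. A t - B t) = (\<lambda>t. poly (p - q) (z t) + ?r t)" by (simp add: algebra_simps)
  then have "(\<lambda>t. A t - B t) \<in> o[at 0](\<lambda>t. t ^ k)
      \<longleftrightarrow> (\<lambda>t. poly (p - q) (z t)) \<in> o[at 0](\<lambda>t. t ^ k)"
    using rest sum_in_smallo(1)[of "\<lambda>t. poly (p - q) (z t)" "at 0" "\<lambda>t. t ^ k" ?r]
      sum_in_smallo(2)[of "\<lambda>t. A t - B t" "at 0" "\<lambda>t. t ^ k" ?r] by auto
  then show ?thesis using poly_smallo_power_iff[OF z, of "p - q" k] by simp
qed

section \<open>The local expansion of a cubic parabola at U\<close>

text \<open>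
  The polynomial \<open>w\<close>, that is, \<open>\<beta>\<close> times the last coordinate of \<open>\<Phi>(s, 1)\<close> (\<open>Phi_last_coordinate\<close>), in expanded
  form, since the expansion of \<open>s\<close> in powers of \<open>z\<close> is computed from its coefficients.
\<close>

definition last_numerator :: "real \<Rightarrow> real \<Rightarrow> real \<Rightarrow> real \<Rightarrow> real" where
  "last_numerator \<alpha> \<beta> \<gamma> s = (3 - \<beta>) / 3 + \<gamma> * (\<beta> - 1) * s + (\<alpha> - \<beta> * \<gamma>^2) * s^2 - \<gamma> * (3 * \<alpha> - \<beta> * \<gamma>^2) / 3 * s^3"

text \<open>
  Fourth-order Taylor polynomials of \<open>x\<^sub>1/x\<^sub>3\<close> and \<open>x\<^sub>0/x\<^sub>3\<close> in the parameter \<open>z = x\<^sub>2/x\<^sub>3\<close>; here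
  \<open>s = mz + cz^2 + dz^3 + O(z^4)\<close>.
\<close>

definition jet_x1 :: "real \<Rightarrow> real \<Rightarrow> real \<Rightarrow> real poly" where
  "jet_x1 \<alpha> \<beta> \<gamma> = (let m = (3 - \<beta>) / 3; c = \<gamma> * (\<beta> - 1) * m;
      d = \<gamma> * (\<beta> - 1) * c + (\<alpha> - \<beta> * \<gamma>^2) * m^2 - \<alpha> * m^3
     in [:0, 0, \<beta> * m, \<beta> * (c - \<gamma> * m^2), \<beta> * (d - 2 * \<gamma> * m * c - \<alpha> * m^3):])"

definition jet_x0 :: "real \<Rightarrow> real \<Rightarrow> real \<Rightarrow> real poly" where
  "jet_x0 \<alpha> \<beta> \<gamma> = (let m = (3 - \<beta>) / 3; c = \<gamma> * (\<beta> - 1) * m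
     in [:0, 0, 0, \<beta> * m^2, 2 * \<beta> * m * c:])"

text \<open>
  The first relation reads \<open>s = z w(s) - \<alpha>s^3\<close>. As each \<open>s\<close> on the right carries a factor \<open>z\<close> or stands in a
  cube, inserting an approximation of \<open>s\<close> there yields one that is better by one power of \<open>z\<close>. Starting with
  \<open>s = O(z)\<close>, three such rounds give \<open>s\<close> up to \<open>O(z^4)\<close>, and the other two relations, used in the same way, give \<open>x\<^sub>1/x\<^sub>3\<close> and \<open>x\<^sub>0/x\<^sub>3\<close>.
  They are stated for functions of a further parameter, so as to apply to every parametrization of the curve.
\<close>

lemma jet_expansion:
  fixes s z X0 X1 :: "real \<Rightarrow> real"
  assumes s0: "(s \<longlongrightarrow> 0) F" and z0: "(z \<longlongrightarrow> 0) F"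
    and z: "\<forall>\<^sub>F t in F. z t * last_numerator \<alpha> \<beta> \<gamma> (s t) = s t + \<alpha> * s t ^ 3"
    and X1: "\<forall>\<^sub>F t in F. X1 t * (1 + \<alpha> * s t ^ 2) = \<beta> * z t * (s t - \<gamma> * s t ^ 2)"
    and X0: "\<forall>\<^sub>F t in F. X0 t * (1 + \<alpha> * s t ^ 2) = \<beta> * z t * s t ^ 2"
  shows "(\<lambda>t. X1 t - poly (jet_x1 \<alpha> \<beta> \<gamma>) (z t)) \<in> O[F](\<lambda>t. z t ^ 5)"
    and "(\<lambda>t. X0 t - poly (jet_x0 \<alpha> \<beta> \<gamma>) (z t)) \<in> O[F](\<lambda>t. z t ^ 5)"
proof -
  define m where "m = (3 - \<beta>) / 3"
  define c1 where "c1 = \<gamma> * (\<beta> - 1)"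
  define c2 where "c2 = \<alpha> - \<beta> * \<gamma>^2"
  define c3 where "c3 = - (\<gamma> * (3 * \<alpha> - \<beta> * \<gamma>^2) / 3)"
  define c where "c = c1 * m"
  define d where "d = c1 * c + c2 * m^2 - \<alpha> * m^3"
  have W: "last_numerator \<alpha> \<beta> \<gamma> x = m + c1 * x + c2 * x^2 + c3 * x^3" for x
    by (simp add: last_numerator_def m_def c1_def c2_def c3_def)
  note mult = bigo_power_mult[of _ F z]
  note mono = bigo_power_mono[OF z0]
  have hz: "(\<lambda>t. z t) \<in> O[F](\<lambda>t. z t ^ 1)" by simp
  have hs: "s \<in> O[F](\<lambda>t. z t ^ 1)"
  proof (rule bigo_if_mult_tendsto_1)
    show "((\<lambda>t. 1 + \<alpha> * s t ^ 2 - z t * (c1 + c2 * s t + c3 * s t ^ 2)) \<longlongrightarrow> 1) F"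
      using s0 z0 by (auto intro!: tendsto_eq_intros)
    show "\<forall>\<^sub>F t in F. s t * (1 + \<alpha> * s t ^ 2 - z t * (c1 + c2 * s t + c3 * s t ^ 2)) = m * z t"
      using z by eventually_elim (simp add: W, algebra)
    show "(\<lambda>t. m * z t) \<in> O[F](\<lambda>t. z t ^ 1)" by simp
  qed
  have hmz: "(\<lambda>t. m * z t) \<in> O[F](\<lambda>t. z t ^ 1)" by simp
  have zs: "(\<lambda>t. z t * s t) \<in> O[F](\<lambda>t. z t ^ 2)" using mult[OF hz hs] by (simp add: numeral_2_eq_2)
  have ss: "(\<lambda>t. s t ^ 2) \<in> O[F](\<lambda>t. z t ^ 2)"
    using mult[OF hs hs] by (simp add: power2_eq_square numeral_2_eq_2)
  have zss: "(\<lambda>t. z t * s t ^ 2) \<in> O[F](\<lambda>t. z t ^ 3)" using mult[OF hz ss] by (simp add: eval_nat_numeral)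
  have sss: "(\<lambda>t. s t ^ 3) \<in> O[F](\<lambda>t. z t ^ 3)"
    using mult[OF hs ss] by (simp add: power3_eq_cube power2_eq_square eval_nat_numeral)
  have zsss: "(\<lambda>t. z t * s t ^ 3) \<in> O[F](\<lambda>t. z t ^ 4)" using mult[OF hz sss] by (simp add: eval_nat_numeral)
  have r1: "(\<lambda>t. s t - m * z t) \<in> O[F](\<lambda>t. z t ^ 2)"
  proof (rule landau_o.big.in_cong[THEN iffD1])
    show "\<forall>\<^sub>F t in F. c1 * (z t * s t) + c2 * (z t * s t ^ 2) + c3 * (z t * s t ^ 3) - \<alpha> * s t ^ 3 = s t - m * z t"
      using z by eventually_elim (simp add: W, algebra)
    show "(\<lambda>t. c1 * (z t * s t) + c2 * (z t * s t ^ 2) + c3 * (z t * s t ^ 3) - \<alpha> * s t ^ 3) \<in> O[F](\<lambda>t. z t ^ 2)"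
      using zs mono[OF _ zss] mono[OF _ zsss] mono[OF _ sss] by (intro sum_in_bigo cmult_in_bigoI) auto
  qed
  have q1: "(\<lambda>t. s t ^ 2 - (m * z t) ^ 2) \<in> O[F](\<lambda>t. z t ^ 3)"
    and q2: "(\<lambda>t. s t ^ 3 - (m * z t) ^ 3) \<in> O[F](\<lambda>t. z t ^ 4)"
    using bigo_power_diff_of_square_cube[OF hs hmz r1] by (simp_all add: eval_nat_numeral)
  have r2: "(\<lambda>t. s t - (m * z t + c * z t ^ 2)) \<in> O[F](\<lambda>t. z t ^ 3)"
  proof (rule landau_o.big.in_cong[THEN iffD1])
    show "\<forall>\<^sub>F t in F. c1 * (z t * (s t - m * z t)) + c2 * (z t * s t ^ 2) + c3 * (z t * s t ^ 3) - \<alpha> * s t ^ 3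
        = s t - (m * z t + c * z t ^ 2)"
      using z by eventually_elim (simp add: W c_def, algebra)
    show "(\<lambda>t. c1 * (z t * (s t - m * z t)) + c2 * (z t * s t ^ 2) + c3 * (z t * s t ^ 3) - \<alpha> * s t ^ 3) \<in> O[F](\<lambda>t. z t ^ 3)"
      using mult[OF hz r1] zss mono[OF _ zsss, of 3] sss
      by (intro sum_in_bigo cmult_in_bigoI) (auto simp: eval_nat_numeral)
  qed
  have r3: "(\<lambda>t. s t - (m * z t + c * z t ^ 2 + d * z t ^ 3)) \<in> O[F](\<lambda>t. z t ^ 4)"
  proof (rule landau_o.big.in_cong[THEN iffD1])
    show "\<forall>\<^sub>F t in F. c1 * (z t * (s t - (m * z t + c * z t ^ 2))) + c2 * (z t * (s t ^ 2 - (m * z t) ^ 2))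
          + c3 * (z t * s t ^ 3) - \<alpha> * (s t ^ 3 - (m * z t) ^ 3)
        = s t - (m * z t + c * z t ^ 2 + d * z t ^ 3)"
      using z by eventually_elim (simp add: W c_def d_def, algebra)
    show "(\<lambda>t. c1 * (z t * (s t - (m * z t + c * z t ^ 2))) + c2 * (z t * (s t ^ 2 - (m * z t) ^ 2))
          + c3 * (z t * s t ^ 3) - \<alpha> * (s t ^ 3 - (m * z t) ^ 3)) \<in> O[F](\<lambda>t. z t ^ 4)"
      using mult[OF hz r2] mult[OF hz q1] zsss
      by (intro sum_in_bigo(2)[OF _ cmult_in_bigoI[OF q2]] sum_in_bigo(1) cmult_in_bigoI) (auto simp: eval_nat_numeral)
  qed
  (* Squaring the second-order approximation of \<open>s\<close> produces, besides the terms needed below, \<open>c^2 z^4\<close>;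
     it is kept here and becomes the summand with \<open>c^2 z^5\<close> in the last two steps. *)
  have q3: "(\<lambda>t. s t ^ 2 - (m * z t + c * z t ^ 2) ^ 2) \<in> O[F](\<lambda>t. z t ^ 4)"
  proof -
    have "(\<lambda>t. z t ^ 2) \<in> O[F](\<lambda>t. z t ^ 1)" by (rule mono[of _ 2]) auto
    then have "(\<lambda>t. m * z t + c * z t ^ 2) \<in> O[F](\<lambda>t. z t ^ 1)"
      by (intro sum_in_bigo cmult_in_bigoI) auto
    from bigo_power_diff_of_square_cube(1)[OF hs this r2] show ?thesis by simp
  qed
  have E: "((\<lambda>t. 1 + \<alpha> * s t ^ 2) \<longlongrightarrow> 1) F" using s0 by (auto intro!: tendsto_eq_intros)
  have hX1: "X1 \<in> O[F](\<lambda>t. z t ^ 2)"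
  proof (rule bigo_if_mult_tendsto_1[OF E X1])
    have "(\<lambda>t. \<beta> * (z t * s t) - \<beta> * \<gamma> * (z t * s t ^ 2)) \<in> O[F](\<lambda>t. z t ^ 2)"
      using zs mono[OF _ zss] by (intro sum_in_bigo cmult_in_bigoI) auto
    then show "(\<lambda>t. \<beta> * z t * (s t - \<gamma> * s t ^ 2)) \<in> O[F](\<lambda>t. z t ^ 2)" by (simp add: algebra_simps)
  qed
  have hX0: "X0 \<in> O[F](\<lambda>t. z t ^ 3)"
    by (rule bigo_if_mult_tendsto_1[OF E X0]) (use zss in \<open>simp add: mult.assoc\<close>)
  have y1: "(\<lambda>t. X1 t - \<beta> * m * z t ^ 2) \<in> O[F](\<lambda>t. z t ^ 3)"
  proof (rule landau_o.big.in_cong[THEN iffD1])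
    show "\<forall>\<^sub>F t in F. \<beta> * (z t * (s t - m * z t)) - \<beta> * \<gamma> * (z t * s t ^ 2) - \<alpha> * (s t ^ 2 * X1 t)
        = X1 t - \<beta> * m * z t ^ 2"
      using X1 by eventually_elim algebra
    show "(\<lambda>t. \<beta> * (z t * (s t - m * z t)) - \<beta> * \<gamma> * (z t * s t ^ 2) - \<alpha> * (s t ^ 2 * X1 t)) \<in> O[F](\<lambda>t. z t ^ 3)"
      using mult[OF hz r1] zss mono[OF _ mult[OF ss hX1], of 3]
      by (intro sum_in_bigo cmult_in_bigoI) (auto simp: eval_nat_numeral)
  qed
  have zz: "(\<lambda>t. z t ^ 2) \<in> O[F](\<lambda>t. z t ^ 2)" "(\<lambda>t. z t ^ 5) \<in> O[F](\<lambda>t. z t ^ 5)" by simp_all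
  show "(\<lambda>t. X1 t - poly (jet_x1 \<alpha> \<beta> \<gamma>) (z t)) \<in> O[F](\<lambda>t. z t ^ 5)"
  proof (rule landau_o.big.in_cong[THEN iffD1])
    show "\<forall>\<^sub>F t in F. \<beta> * (z t * (s t - (m * z t + c * z t ^ 2 + d * z t ^ 3)))
        - \<beta> * \<gamma> * (z t * (s t ^ 2 - (m * z t + c * z t ^ 2) ^ 2)) - \<beta> * \<gamma> * c^2 * z t ^ 5
        - \<alpha> * ((s t ^ 2 - (m * z t) ^ 2) * X1 t) - \<alpha> * m^2 * (z t ^ 2 * (X1 t - \<beta> * m * z t ^ 2))
        = X1 t - poly (jet_x1 \<alpha> \<beta> \<gamma>) (z t)"
      using X1
    proof eventually_elim
      case (elim t)
      have "poly (jet_x1 \<alpha> \<beta> \<gamma>) (z t) = \<beta> * m * z t ^ 2 + \<beta> * (c - \<gamma> * m^2) * z t ^ 3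
        + \<beta> * (d - 2 * \<gamma> * m * c - \<alpha> * m^3) * z t ^ 4"
        unfolding jet_x1_def Let_def c_def d_def c1_def c2_def m_def
        by (simp add: eval_nat_numeral algebra_simps)
      with elim show ?case by algebra
    qed
    show "(\<lambda>t. \<beta> * (z t * (s t - (m * z t + c * z t ^ 2 + d * z t ^ 3)))
        - \<beta> * \<gamma> * (z t * (s t ^ 2 - (m * z t + c * z t ^ 2) ^ 2)) - \<beta> * \<gamma> * c^2 * z t ^ 5
        - \<alpha> * ((s t ^ 2 - (m * z t) ^ 2) * X1 t) - \<alpha> * m^2 * (z t ^ 2 * (X1 t - \<beta> * m * z t ^ 2)))
        \<in> O[F](\<lambda>t. z t ^ 5)"
      using mult[OF hz r3] mult[OF hz q3] mult[OF q1 hX1] mult[OF zz(1) y1]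
      by (intro sum_in_bigo cmult_in_bigoI) (auto simp: eval_nat_numeral)
  qed
  show "(\<lambda>t. X0 t - poly (jet_x0 \<alpha> \<beta> \<gamma>) (z t)) \<in> O[F](\<lambda>t. z t ^ 5)"
  proof (rule landau_o.big.in_cong[THEN iffD1])
    show "\<forall>\<^sub>F t in F. \<beta> * (z t * (s t ^ 2 - (m * z t + c * z t ^ 2) ^ 2)) + \<beta> * c^2 * z t ^ 5 - \<alpha> * (s t ^ 2 * X0 t)
        = X0 t - poly (jet_x0 \<alpha> \<beta> \<gamma>) (z t)"
      using X0
    proof eventually_elim
      case (elim t)
      have "poly (jet_x0 \<alpha> \<beta> \<gamma>) (z t) = \<beta> * m^2 * z t ^ 3 + 2 * \<beta> * m * c * z t ^ 4"
        unfolding jet_x0_def Let_def c_def c1_def m_def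
        by (simp add: eval_nat_numeral algebra_simps)
      with elim show ?case by algebra
    qed
    show "(\<lambda>t. \<beta> * (z t * (s t ^ 2 - (m * z t + c * z t ^ 2) ^ 2)) + \<beta> * c^2 * z t ^ 5 - \<alpha> * (s t ^ 2 * X0 t)) \<in> O[F](\<lambda>t. z t ^ 5)"
      using mult[OF hz q3] mult[OF ss hX0]
      by (intro sum_in_bigo cmult_in_bigoI) (auto simp: eval_nat_numeral)
  qed
qed

lemma jets_eq_iff:
  fixes \<alpha> \<beta> \<gamma> \<alpha>' \<beta>' \<gamma>' :: real
  defines "agree \<equiv> \<lambda>k::nat. \<forall>i\<le>k. coeff (jet_x1 \<alpha> \<beta> \<gamma>) i = coeff (jet_x1 \<alpha>' \<beta>' \<gamma>') i
      \<and> coeff (jet_x0 \<alpha> \<beta> \<gamma>) i = coeff (jet_x0 \<alpha>' \<beta>' \<gamma>') i"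
  assumes "\<beta> \<notin> {0, 3}" and "\<beta>' \<notin> {0, 3}"
  shows "agree 2 \<longleftrightarrow> \<beta> = \<beta>' \<or> \<beta> = 3 - \<beta>'"
    and "agree 3 \<longleftrightarrow> \<beta> = \<beta>' \<and> (\<gamma> = \<gamma>' \<or> \<beta>' = 3 / 2)"
    and "agree 4 \<longleftrightarrow> \<beta> = \<beta>' \<and> \<gamma> = \<gamma>' \<and> (\<alpha> = \<alpha>' \<or> \<beta>' = 3 / 2)"
proof -
  have le: "(\<forall>i\<le>2. P i) \<longleftrightarrow> P 0 \<and> P 1 \<and> P 2"
    "(\<forall>i\<le>3. P i) \<longleftrightarrow> (\<forall>i\<le>2. P i) \<and> P 3"
    "(\<forall>i\<le>4. P i) \<longleftrightarrow> (\<forall>i\<le>3. P i) \<and> P 4" for P :: "nat \<Rightarrow> bool"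
    by (auto simp: eval_nat_numeral le_Suc_eq)
  show a2: "agree 2 \<longleftrightarrow> \<beta> = \<beta>' \<or> \<beta> = 3 - \<beta>'"
  proof -
    have "agree 2 \<longleftrightarrow> \<beta> * (3 - \<beta>) = \<beta>' * (3 - \<beta>')"
      unfolding agree_def le jet_x1_def jet_x0_def Let_def by (auto simp: numeral_2_eq_2)
    also have "\<dots> \<longleftrightarrow> (\<beta> - \<beta>') * (3 - \<beta> - \<beta>') = 0" by (auto simp: algebra_simps)
    finally show ?thesis by auto
  qed
  have jet_x0_3: "coeff (jet_x0 \<alpha> \<beta> \<gamma>) 3 = \<beta> * ((3 - \<beta>) / 3)^2"
    and jet_x0_4: "coeff (jet_x0 \<alpha> \<beta> \<gamma>) 4 = 2 * \<beta> * (\<beta> - 1) * ((3 - \<beta>) / 3)^2 * \<gamma>"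
    and jet_x1_3: "coeff (jet_x1 \<alpha> \<beta> \<gamma>) 3 = \<beta> * (3 - \<beta>) * (4 * \<beta> - 6) * \<gamma> / 9" for \<alpha> \<beta> \<gamma>
    by (simp_all add: jet_x0_def jet_x1_def Let_def eval_nat_numeral field_simps)
  show a3: "agree 3 \<longleftrightarrow> \<beta> = \<beta>' \<and> (\<gamma> = \<gamma>' \<or> \<beta>' = 3 / 2)"
  proof -
    have "agree 3 \<longleftrightarrow> agree 2 \<and> \<beta> * ((3 - \<beta>) / 3)^2 = \<beta>' * ((3 - \<beta>') / 3)^2
        \<and> \<beta> * (3 - \<beta>) * (4 * \<beta> - 6) * \<gamma> / 9 = \<beta>' * (3 - \<beta>') * (4 * \<beta>' - 6) * \<gamma>' / 9"
      unfolding agree_def le jet_x0_3 jet_x1_3 by auto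
    also have "\<dots> \<longleftrightarrow> \<beta> = \<beta>' \<and> (\<gamma> = \<gamma>' \<or> \<beta>' = 3 / 2)"
    proof -
      have "\<beta> = \<beta>'" if "\<beta> = 3 - \<beta>'" "\<beta> * ((3 - \<beta>) / 3)^2 = \<beta>' * ((3 - \<beta>') / 3)^2"
      proof -
        have "(3 - \<beta>') * \<beta>' * (2 * \<beta>' - 3) = 0"
          using that(2) unfolding that(1) by (simp add: field_simps power2_eq_square)
        with assms show ?thesis using that(1) by auto
      qed
      moreover have "\<beta>' * (3 - \<beta>') * (4 * \<beta>' - 6) * \<gamma> / 9 = \<beta>' * (3 - \<beta>') * (4 * \<beta>' - 6) * \<gamma>' / 9
          \<longleftrightarrow> (\<gamma> = \<gamma>' \<or> \<beta>' = 3 / 2)"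
        using assms by auto
      ultimately show ?thesis unfolding a2 by metis
    qed
    finally show ?thesis .
  qed
  show "agree 4 \<longleftrightarrow> \<beta> = \<beta>' \<and> \<gamma> = \<gamma>' \<and> (\<alpha> = \<alpha>' \<or> \<beta>' = 3 / 2)"
  proof -
    have "agree 4 \<longleftrightarrow> agree 3
        \<and> 2 * \<beta> * (\<beta> - 1) * ((3 - \<beta>) / 3)^2 * \<gamma> = 2 * \<beta>' * (\<beta>' - 1) * ((3 - \<beta>') / 3)^2 * \<gamma>'
        \<and> coeff (jet_x1 \<alpha> \<beta> \<gamma>) 4 = coeff (jet_x1 \<alpha>' \<beta>' \<gamma>') 4"
      unfolding agree_def le jet_x0_4 by auto
    also have "\<dots> \<longleftrightarrow> \<beta> = \<beta>' \<and> \<gamma> = \<gamma>' \<and> coeff (jet_x1 \<alpha> \<beta> \<gamma>) 4 = coeff (jet_x1 \<alpha>' \<beta> \<gamma>) 4"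
      unfolding a3 using assms by auto
    (* At this point only \<open>\<alpha>\<close> and \<open>\<alpha>'\<close> can differ, so only the \<open>\<alpha>\<close>-dependence of the coefficient matters. *)
    also have "coeff (jet_x1 \<alpha> \<beta> \<gamma>) 4 = coeff (jet_x1 \<alpha>' \<beta> \<gamma>) 4 \<longleftrightarrow> \<alpha> = \<alpha>' \<or> \<beta> = 3 / 2"
    proof -
      have "coeff (jet_x1 \<alpha> \<beta> \<gamma>) 4 - coeff (jet_x1 \<alpha>' \<beta> \<gamma>) 4
          = \<beta> * ((3 - \<beta>) / 3)^2 * (2 * \<beta> - 3) * (\<alpha> - \<alpha>') / 3" (is "?l = ?r")
        by (simp add: jet_x1_def Let_def eval_nat_numeral field_simps)
      then have "coeff (jet_x1 \<alpha> \<beta> \<gamma>) 4 = coeff (jet_x1 \<alpha>' \<beta> \<gamma>) 4 \<longleftrightarrow> ?r = 0"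
        by (metis eq_iff_diff_eq_0)
      then show ?thesis using assms by auto
    qed
    finally show ?thesis by auto
  qed
qed

section \<open>Smooth curves and their Taylor coefficients\<close>

lemma has_vector_derivative_vec_iff:
  fixes f :: "real \<Rightarrow> real ^ 'n"
  shows "(f has_vector_derivative D) (at x) \<longleftrightarrow> (\<forall>i. ((\<lambda>t. f t $ i) has_real_derivative D $ i) (at x))"
  unfolding has_vector_derivative_def has_derivative_componentwise_within[of f] has_field_derivative_def
  by (simp add: Basis_vec_def inner_axis mult_commute_abs)

lemma has_vector_derivative_iter_vderiv:
  assumes "smooth_on I g" "t \<in> I"
  shows "(iter_vderiv n g has_vector_derivative iter_vderiv (Suc n) g t) (at t)"
  using assms vector_derivative_works unfolding smooth_on_def by (fastforce simp: iter_vderiv_def)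

text \<open>
  Smoothness refers to iterated derivatives, which are hard to control one by one; a class of functions with known
  derivatives that is stable under differentiation controls all of them by induction.
\<close>

lemma smooth_on_if_derivative_closed:
  assumes I: "open I" and g: "g \<in> A"
    and closed: "\<And>f. f \<in> A \<Longrightarrow> \<exists>f'\<in>A. \<forall>t\<in>I. (f has_vector_derivative f' t) (at t)"
  shows "smooth_on I g"
proof -
  have iter: "\<exists>f\<in>A. \<forall>t\<in>I. iter_vderiv n g t = f t" for n
  proof (induction n)
    case 0
    then show ?case using g by (auto simp: iter_vderiv_def)
  next
    case (Suc n)
    then obtain f where f: "f \<in> A" "\<And>t. t \<in> I \<Longrightarrow> iter_vderiv n g t = f t" by blast
    obtain f' where f': "f' \<in> A" "\<And>t. t \<in> I \<Longrightarrow> (f has_vector_derivative f' t) (at t)"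
      using closed[OF f(1)] by blast
    have "iter_vderiv (Suc n) g t = f' t" if "t \<in> I" for t
    proof -
      have "(iter_vderiv n g has_vector_derivative f' t) (at t)"
        using f'(2)[OF that] I that by (rule has_vector_derivative_transform_within_open) (simp add: f)
      then show ?thesis by (simp add: iter_vderiv_def vector_derivative_at)
    qed
    with f'(1) show ?case by blast
  qed
  show ?thesis unfolding smooth_on_def
  proof (intro allI ballI)
    fix n t assume t: "t \<in> I"
    obtain f where f: "f \<in> A" "\<And>t. t \<in> I \<Longrightarrow> iter_vderiv n g t = f t" using iter by blast
    then obtain f' where "(f has_vector_derivative f' t) (at t)" using closed t by blast
    then have "(iter_vderiv n g has_vector_derivative f' t) (at t)"
      using I t by (rule has_vector_derivative_transform_within_open) (simp add: f)
    then show "iter_vderiv n g differentiable at t" by (rule differentiableI_vector)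
  qed
qed

text \<open>
  Quotients by arbitrary powers of one denominator form a class as in \<open>smooth_on_if_derivative_closed\<close>.
\<close>

lemma smooth_on_rational_curve:
  fixes P :: "'n::finite \<Rightarrow> real poly"
  assumes "open I" and nz: "\<And>t. t \<in> I \<Longrightarrow> poly q t \<noteq> 0"
  shows "smooth_on I (\<lambda>t. \<chi> i. poly (P i) t / poly q t)"
proof (rule smooth_on_if_derivative_closed[OF assms(1)])
  let ?A = "{(\<lambda>t. \<chi> i. poly (P i) t / poly q t ^ k) | P k. True} :: (real \<Rightarrow> real ^ 'n) set"
  show "(\<lambda>t. \<chi> i. poly (P i) t / poly q t) \<in> ?A" by (rule CollectI, rule exI[of _ P], rule exI[of _ 1]) simp
  show "\<exists>f'\<in>?A. \<forall>t\<in>I. (f has_vector_derivative f' t) (at t)" if f_in: "f \<in> ?A" for f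
  proof -
    obtain P k where f: "f = (\<lambda>t. \<chi> i. poly (P i) t / poly q t ^ k)" using f_in by blast
    define Q where "Q i = pderiv (P i) * q - smult (of_nat k) (P i * pderiv q)" for i
    have "((\<lambda>t. poly (P i) t / poly q t ^ k) has_real_derivative poly (Q i) t / poly q t ^ Suc k) (at t)"
      if t: "t \<in> I" for t i
    proof -
      have "((\<lambda>t. poly (P i) t / poly q t ^ k) has_real_derivative
          (poly (pderiv (P i)) t * poly q t ^ k - poly (P i) t * (real k * (poly (pderiv q) t * poly q t ^ (k - 1))))
            / (poly q t ^ k * poly q t ^ k)) (at t)"
        using nz[OF t] by (auto intro!: derivative_eq_intros poly_DERIV)
      also have "(poly (pderiv (P i)) t * poly q t ^ k - poly (P i) t * (real k * (poly (pderiv q) t * poly q t ^ (k - 1))))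
            / (poly q t ^ k * poly q t ^ k) = poly (Q i) t / poly q t ^ Suc k"
        using nz[OF t] by (cases k) (simp_all add: Q_def field_simps)
      finally show ?thesis .
    qed
    then have "\<forall>t\<in>I. (f has_vector_derivative (\<chi> i. poly (Q i) t / poly q t ^ Suc k)) (at t)"
      unfolding has_vector_derivative_vec_iff f by simp
    then show ?thesis by (intro bexI[of _ "\<lambda>t. \<chi> i. poly (Q i) t / poly q t ^ Suc k"]) blast+
  qed
qed

text \<open>
  Taylor's formula with Lagrange remainder for each component; its intermediate point varies with \<open>t\<close>, but the
  derivative of order \<open>k + 1\<close> is bounded on a compact interval around \<open>0\<close>.
\<close>

lemma Taylor_bigo:
  fixes g :: "real \<Rightarrow> real ^ 'n"
  assumes I: "open I" "0 \<in> I" and g: "smooth_on I g"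
  shows "(\<lambda>t. g t $ j - (\<Sum>i\<le>k. taylor_coeff g i $ j * t ^ i)) \<in> O[at 0](\<lambda>t. t ^ Suc k)"
proof -
  define D where "D n t = iter_vderiv n g t $ j" for n t
  have D: "(D n has_real_derivative D (Suc n) t) (at t)" if "t \<in> I" for n t
    using has_vector_derivative_iter_vderiv[OF g that, of n]
    unfolding has_vector_derivative_vec_iff D_def by blast
  obtain e where e: "e > 0" "cball 0 e \<subseteq> I" using I open_contains_cball by blast
  have "continuous_on (cball 0 e) (D (Suc k))"
    by (intro continuous_at_imp_continuous_on ballI DERIV_isCont[OF D]) (use e in blast)
  then have "bounded (D (Suc k) ` cball 0 e)" by (intro compact_imp_bounded compact_continuous_image) auto
  then obtain M where M: "\<And>t. t \<in> cball 0 e \<Longrightarrow> \<bar>D (Suc k) t\<bar> \<le> M"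
    unfolding bounded_iff real_norm_def by blast
  have "norm (g t $ j - (\<Sum>i\<le>k. taylor_coeff g i $ j * t ^ i)) \<le> M / fact (Suc k) * norm (t ^ Suc k)"
    if t: "\<bar>t\<bar> \<le> e" for t
  proof -
    have "\<exists>u. \<bar>u\<bar> \<le> \<bar>t\<bar> \<and> D 0 t = (\<Sum>m<Suc k. D m 0 / fact m * t ^ m) + D (Suc k) u / fact (Suc k) * t ^ Suc k"
      by (rule Maclaurin_bi_le) (use t e D in \<open>auto simp: subset_iff\<close>)
    then obtain u where u: "\<bar>u\<bar> \<le> \<bar>t\<bar>"
      "D 0 t = (\<Sum>m<Suc k. D m 0 / fact m * t ^ m) + D (Suc k) u / fact (Suc k) * t ^ Suc k" by blast
    have "g t $ j - (\<Sum>i\<le>k. taylor_coeff g i $ j * t ^ i) = D (Suc k) u / fact (Suc k) * t ^ Suc k"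
      using u(2) by (simp add: lessThan_Suc_atMost taylor_coeff_def D_def iter_vderiv_def divide_inverse mult.commute)
    then have "norm (g t $ j - (\<Sum>i\<le>k. taylor_coeff g i $ j * t ^ i))
        = \<bar>D (Suc k) u\<bar> / fact (Suc k) * norm (t ^ Suc k)" by (simp add: abs_mult)
    also have "\<dots> \<le> M / fact (Suc k) * norm (t ^ Suc k)"
      using M[of u] u(1) t by (intro mult_right_mono divide_right_mono) auto
    finally show ?thesis .
  qed
  then have "\<forall>\<^sub>F t in at 0. norm (g t $ j - (\<Sum>i\<le>k. taylor_coeff g i $ j * t ^ i)) \<le> M / fact (Suc k) * norm (t ^ Suc k)"
    using e(1) unfolding eventually_at by (intro exI[of _ e]) (auto simp: dist_norm)
  then show ?thesis by (rule bigoI)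
qed

text \<open>
  Both curves differ from their Taylor polynomials by \<open>o(t^k)\<close>, and a polynomial of degree at most \<open>k\<close> that is
  \<open>o(t^k)\<close> vanishes. This replaces contact by a condition that is stable under changes of coordinates.
\<close>

lemma taylor_coeffs_eq_iff_smallo:
  fixes g h :: "real \<Rightarrow> real ^ 'n"
  assumes g: "open I" "0 \<in> I" "smooth_on I g" and h: "open J" "0 \<in> J" "smooth_on J h"
  shows "(\<forall>i\<le>k. taylor_coeff g i = taylor_coeff h i) \<longleftrightarrow> (\<forall>j. (\<lambda>t. g t $ j - h t $ j) \<in> o[at 0](\<lambda>t. t ^ k))"
proof -
  have small: "(\<lambda>t. t ^ Suc k) \<in> o[at 0](\<lambda>t. t ^ k :: real)"
  proof -
    have "(\<lambda>t. t) \<in> o[at 0](\<lambda>_. 1 :: real)" by (rule smalloI_tendsto) (auto intro!: tendsto_eq_intros)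
    then show ?thesis using landau_o.small.mult_right[of "\<lambda>t. t" "at 0" "\<lambda>_. 1" "\<lambda>t. t ^ k"] by simp
  qed
  define T where "T f j = (\<Sum>i\<le>k. monom (taylor_coeff f i $ j) i)" for f :: "real \<Rightarrow> real ^ 'n" and j
  have T: "poly (T f j) t = (\<Sum>i\<le>k. taylor_coeff f i $ j * t ^ i)" for f j t
    by (simp add: T_def poly_sum poly_monom)
  have coeff: "coeff (T f j) i = taylor_coeff f i $ j" if "i \<le> k" for f j i
    using that by (simp add: T_def coeff_sum)
  have "(\<lambda>t. g t $ j - h t $ j) \<in> o[at 0](\<lambda>t. t ^ k) \<longleftrightarrow> (\<forall>i\<le>k. taylor_coeff g i $ j = taylor_coeff h i $ j)" for j
  proof -
    have "(\<lambda>t. g t $ j - poly (T g j) t) \<in> o[at 0](\<lambda>t. t ^ k)" "(\<lambda>t. h t $ j - poly (T h j) t) \<in> o[at 0](\<lambda>t. t ^ k)"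
      using Taylor_bigo[OF g] Taylor_bigo[OF h] small unfolding T by (blast intro: landau_o.big_small_trans)+
    then have "(\<lambda>t. g t $ j - h t $ j) \<in> o[at 0](\<lambda>t. t ^ k) \<longleftrightarrow> (\<forall>i\<le>k. coeff (T g j) i = coeff (T h j) i)"
      by (intro smallo_diff_iff_coeff_eq[where z = "\<lambda>t. t" and y = "\<lambda>t. t"]) auto
    then show ?thesis by (simp add: coeff)
  qed
  then show ?thesis by (auto simp: vec_eq_iff)
qed

section \<open>Regular parametrizations of a cubic parabola near U\<close>

lemma Phi_last_coordinate: "\<beta> \<noteq> 0 \<Longrightarrow> Phi \<alpha> \<beta> \<gamma> (vector [s, 1]) $ 4 = last_numerator \<alpha> \<beta> \<gamma> s / \<beta>"
  by (simp add: Phi_def last_numerator_def field_simps power2_eq_square power3_eq_cube)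

text \<open>
  For \<open>\<beta> \<noteq> 0, 3\<close> the coordinates of \<open>\<Phi>(u)\<close> span the binary cubic forms in \<open>u\<^sub>0, u\<^sub>1\<close>. The two linear forms below
  pull back to \<open>u\<^sub>0u\<^sub>1^2\<close> and \<open>u\<^sub>1^3\<close> (\<open>forms_Phi\<close>), so their quotient is the curve parameter \<open>s\<close> as a
  continuous function of the point of the curve.
\<close>

definition form_u0_u1_sq :: "real \<Rightarrow> real \<Rightarrow> real^4 \<Rightarrow> real" where
  "form_u0_u1_sq \<alpha> \<beta> x = \<beta> * x$3 - \<alpha> * x$1"

definition form_u1_cube :: "real \<Rightarrow> real \<Rightarrow> real \<Rightarrow> real^4 \<Rightarrow> real" where
  "form_u1_cube \<alpha> \<beta> \<gamma> x = (3 * \<beta> * x$4 - 3 * \<gamma> * (\<beta> - 1) * form_u0_u1_sq \<alpha> \<beta> x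
     - 3 * (\<alpha> - \<beta> * \<gamma>^2) * (x$2 + \<gamma> * x$1) + \<gamma> * (3 * \<alpha> - \<beta> * \<gamma>^2) * x$1) / (3 - \<beta>)"

lemma forms_scaleR:
  "form_u0_u1_sq \<alpha> \<beta> (r *\<^sub>R x) = r * form_u0_u1_sq \<alpha> \<beta> x" "form_u1_cube \<alpha> \<beta> \<gamma> (r *\<^sub>R x) = r * form_u1_cube \<alpha> \<beta> \<gamma> x"
  by (simp_all add: form_u0_u1_sq_def form_u1_cube_def algebra_simps add_divide_distrib diff_divide_distrib)

lemma forms_Phi:
  assumes "\<beta> \<noteq> 0" "\<beta> \<noteq> 3"
  shows "form_u0_u1_sq \<alpha> \<beta> (Phi \<alpha> \<beta> \<gamma> u) = u$1 * (u$2)^2" and "form_u1_cube \<alpha> \<beta> \<gamma> (Phi \<alpha> \<beta> \<gamma> u) = (u$2)^3"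
proof -
  show e2: "form_u0_u1_sq \<alpha> \<beta> (Phi \<alpha> \<beta> \<gamma> u) = u$1 * (u$2)^2"
    using assms by (simp add: form_u0_u1_sq_def Phi_def field_simps power2_eq_square power3_eq_cube)
  have "3 * \<beta> * Phi \<alpha> \<beta> \<gamma> u $ 4
      = (u$2 - \<gamma> * u$1) * (3 * ((u$2)^2 + \<alpha> * (u$1)^2) - \<beta> * (u$2 - \<gamma> * u$1)^2)"
    using assms by (simp add: Phi_def)
  then have "(3 - \<beta>) * form_u1_cube \<alpha> \<beta> \<gamma> (Phi \<alpha> \<beta> \<gamma> u) = (3 - \<beta>) * (u$2)^3"
    using assms(2) unfolding form_u1_cube_def e2
    by (simp add: \<open>3 * \<beta> * Phi \<alpha> \<beta> \<gamma> u $ 4 = _\<close>) (simp add: Phi_def algebra_simps power2_eq_square power3_eq_cube)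
  then show "form_u1_cube \<alpha> \<beta> \<gamma> (Phi \<alpha> \<beta> \<gamma> u) = (u$2)^3" using assms by simp
qed

lemma cubic_parabola_eq_Phi:
  assumes \<beta>: "\<beta> \<noteq> 0" "\<beta> \<noteq> 3" and x: "span {x} \<in> cubic_parabola \<alpha> \<beta> \<gamma>" and nz: "form_u1_cube \<alpha> \<beta> \<gamma> x \<noteq> 0"
  shows "x = form_u1_cube \<alpha> \<beta> \<gamma> x *\<^sub>R Phi \<alpha> \<beta> \<gamma> (vector [form_u0_u1_sq \<alpha> \<beta> x / form_u1_cube \<alpha> \<beta> \<gamma> x, 1])"
proof -
  obtain u where "span {x} = span {Phi \<alpha> \<beta> \<gamma> u}" using x unfolding cubic_parabola_def by blast
  then have "x \<in> span {Phi \<alpha> \<beta> \<gamma> u}" using span_base[of x "{x}"] by blast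
  then obtain r where r: "x = r *\<^sub>R Phi \<alpha> \<beta> \<gamma> u" by (auto simp: span_singleton)
  have e: "form_u0_u1_sq \<alpha> \<beta> x = r * (u$1 * (u$2)^2)" "form_u1_cube \<alpha> \<beta> \<gamma> x = r * (u$2)^3"
    by (simp_all add: r forms_scaleR forms_Phi[OF \<beta>])
  with nz have u2: "r \<noteq> 0" "u$2 \<noteq> 0" by auto
  have "u = u$2 *\<^sub>R vector [u$1 / u$2, 1]" using u2 by (simp add: vec_eq_iff forall_2)
  then have "Phi \<alpha> \<beta> \<gamma> u = (u$2)^3 *\<^sub>R Phi \<alpha> \<beta> \<gamma> (vector [u$1 / u$2, 1])" by (metis Phi_scaleR)
  moreover have "form_u0_u1_sq \<alpha> \<beta> x / form_u1_cube \<alpha> \<beta> \<gamma> x = u$1 / u$2"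
    using u2 by (simp add: e field_simps power2_eq_square power3_eq_cube)
  ultimately show ?thesis using r e by simp
qed

lemma bigtheta_if_derivative_nonzero:
  fixes z :: "real \<Rightarrow> real"
  assumes "(z has_real_derivative D) (at 0)" "z 0 = 0" "D \<noteq> 0"
  shows "z \<in> \<Theta>[at 0](\<lambda>t. t)"
proof -
  have "((\<lambda>t. z t / t) \<longlongrightarrow> D) (at 0)" using assms(1,2) by (simp add: DERIV_def)
  then show ?thesis using assms(3) by (intro bigthetaI_tendsto) (auto simp: eventually_at_filter)
qed

text \<open>
  For every regular parametrization \<open>g\<close> in every chart, the vector \<open>G(t)\<close> of homogeneous coordinates
  is a multiple of \<open>\<Phi>(s(t), 1)\<close>, where \<open>s(t)\<close> tends to \<open>0\<close>, so that the relations of \<open>jet_expansion\<close> hold. The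
  function \<open>z\<close> has a nonzero derivative at \<open>0\<close>: by these relations \<open>x\<^sub>0/x\<^sub>2\<close> and \<open>x\<^sub>1/x\<^sub>2\<close> tend to \<open>0\<close>, hence the
  first two components of \<open>G'(0)\<close> vanish; if the third vanished, too, \<open>G'(0)\<close> would be a multiple of \<open>G(0)\<close>,
  contrary to \<open>g'(0) \<noteq> 0\<close>.
\<close>

lemma regular_local_param_at_U:
  fixes L :: "real \<times> (real^3) \<Rightarrow> real^4"
  assumes \<beta>: "\<beta> \<noteq> 0" "\<beta> \<noteq> 3" and L: "affine_chart L"
    and g: "regular_local_param L (cubic_parabola \<alpha> \<beta> \<gamma>) point_U g"
  defines "G \<equiv> \<lambda>t. L (1, g t)"
  defines "z \<equiv> \<lambda>t. G t $ 3 / G t $ 4"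
  shows "isCont G 0" and "G 0 $ 4 \<noteq> 0" and "z \<in> \<Theta>[at 0](\<lambda>t. t)"
    and "(\<lambda>t. G t $ 2 / G t $ 4 - poly (jet_x1 \<alpha> \<beta> \<gamma>) (z t)) \<in> O[at 0](\<lambda>t. t ^ 5)"
    and "(\<lambda>t. G t $ 1 / G t $ 4 - poly (jet_x0 \<alpha> \<beta> \<gamma>) (z t)) \<in> O[at 0](\<lambda>t. t ^ 5)"
proof -
  have lin: "linear L" and inj: "inj L" using L by (auto simp: affine_chart_def bij_def)
  obtain e where e: "e > 0" and smooth: "smooth_on {-e<..<e} g"
    and reg: "\<And>t. t \<in> {-e<..<e} \<Longrightarrow> vector_derivative g (at t) \<noteq> 0"
    and op: "openin (top_of_set (in_chart L (cubic_parabola \<alpha> \<beta> \<gamma>))) (g ` {-e<..<e})"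
    using g unfolding regular_local_param_def Let_def by blast
  have on_curve: "span {G t} \<in> cubic_parabola \<alpha> \<beta> \<gamma>" if "t \<in> {-e<..<e}" for t
    using openin_imp_subset[OF op] that unfolding in_chart_def G_def by blast
  have near: "\<forall>\<^sub>F t in at 0. t \<in> {-e<..<e}" using e by (intro eventually_at_in_open') auto

  define v where "v = L (0, vector_derivative g (at 0))"
  have v: "(G has_vector_derivative v) (at 0)"
  proof -
    have "iter_vderiv 0 g differentiable (at 0)" using smooth e unfolding smooth_on_def by auto
    then have "(g has_vector_derivative vector_derivative g (at 0)) (at 0)"
      by (simp add: iter_vderiv_def vector_derivative_works)
    then have "((\<lambda>t. (1, g t)) has_vector_derivative (0, vector_derivative g (at 0))) (at 0)"
      by (auto intro!: has_vector_derivative_Pair derivative_eq_intros)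
    from bounded_linear.has_vector_derivative[OF _ this, of L] show ?thesis
      using lin by (simp add: linear_conv_bounded_linear G_def v_def)
  qed
  show cont: "isCont G 0" using v by (rule has_vector_derivative_continuous)
  have limG: "(G \<longlongrightarrow> G 0) (at 0)" using cont by (simp add: isCont_def)
  then have lim: "((\<lambda>t. G t $ i) \<longlongrightarrow> G 0 $ i) (at 0)" for i
    by (rule tendsto_vec_nth)

  have "span {G 0} = span {vector [0, 0, 0, 1]}"
    using g unfolding regular_local_param_def point_U_def G_def by blast
  then have "G 0 \<in> span {vector [0, 0, 0, 1]}" using span_base[of "G 0" "{G 0}"] by blast
  then obtain l where l: "G 0 = l *\<^sub>R vector [0, 0, 0, 1]" by (auto simp: span_singleton)
  have G0: "G 0 $ 1 = 0" "G 0 $ 2 = 0" "G 0 $ 3 = 0" "G 0 $ 4 = l" by (simp_all add: l)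
  have "G 0 \<noteq> 0"
  proof
    assume "G 0 = 0"
    then have "L (1, g 0) = L 0" using linear_0[OF lin] by (simp add: G_def)
    then have "(1 :: real, g 0) = 0" by (rule injD[OF inj])
    then show False by (simp add: zero_prod_def)
  qed
  then have "l \<noteq> 0" using l by auto
  then show G04: "G 0 $ 4 \<noteq> 0" by (simp add: G0)

  define N where "N t = form_u1_cube \<alpha> \<beta> \<gamma> (G t)" for t
  define s where "s t = form_u0_u1_sq \<alpha> \<beta> (G t) / N t" for t
  have N: "(N \<longlongrightarrow> 3 * \<beta> * l / (3 - \<beta>)) (at 0)"
    unfolding N_def form_u1_cube_def form_u0_u1_sq_def using \<beta> by (auto intro!: tendsto_eq_intros limG simp: G0)
  then have N_nz: "\<forall>\<^sub>F t in at 0. N t \<noteq> 0"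
    by (rule tendsto_imp_eventually_ne) (use \<beta> \<open>l \<noteq> 0\<close> in auto)
  have G4_nz: "\<forall>\<^sub>F t in at 0. G t $ 4 \<noteq> 0" using lim G04 by (rule tendsto_imp_eventually_ne)
  have s: "(s \<longlongrightarrow> 0) (at 0)"
    unfolding s_def form_u0_u1_sq_def using \<beta> \<open>l \<noteq> 0\<close> by (auto intro!: tendsto_eq_intros limG N simp: G0)
  have coords: "\<forall>\<^sub>F t in at 0. G t $ 1 = N t * s t ^ 3 \<and> G t $ 2 = N t * (s t ^ 2 * (1 - \<gamma> * s t))
      \<and> G t $ 3 = N t * (s t * (1 + \<alpha> * s t ^ 2) / \<beta>) \<and> G t $ 4 = N t * (last_numerator \<alpha> \<beta> \<gamma> (s t) / \<beta>)"
    using near N_nz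
  proof eventually_elim
    case (elim t)
    have "G t = N t *\<^sub>R Phi \<alpha> \<beta> \<gamma> (vector [s t, 1])"
      using cubic_parabola_eq_Phi[OF \<beta> on_curve[OF elim(1)]] elim(2) unfolding s_def N_def by blast
    then have c: "G t $ i = N t * Phi \<alpha> \<beta> \<gamma> (vector [s t, 1]) $ i" for i by simp
    show ?case unfolding c Phi_last_coordinate[OF \<beta>(1)] by (simp add: Phi_def)
  qed

  have deriv: "((\<lambda>t. G t $ i) has_real_derivative v $ i) (at 0)" for i
    using v unfolding has_vector_derivative_vec_iff by blast
  have quot: "((\<lambda>t. G t $ i / t) \<longlongrightarrow> v $ i) (at 0)" if "i \<noteq> 4" for i
  proof -
    have "G 0 $ i = 0" using that G0 exhaust_4[of i] by auto
    then show ?thesis using deriv[of i] by (simp add: DERIV_def)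
  qed
  have E: "\<forall>\<^sub>F t in at 0. 1 + \<alpha> * s t ^ 2 \<noteq> 0"
    by (rule tendsto_imp_eventually_ne[where c = 1]) (auto intro!: tendsto_eq_intros s)
  have v2: "v $ 2 = 0"
  proof -
    have "((\<lambda>t. \<beta> * s t * (1 - \<gamma> * s t) / (1 + \<alpha> * s t ^ 2)) \<longlongrightarrow> 0) (at 0)"
      by (auto intro!: tendsto_eq_intros s)
    then have "((\<lambda>t. G t $ 3 / t * (\<beta> * s t * (1 - \<gamma> * s t) / (1 + \<alpha> * s t ^ 2))) \<longlongrightarrow> v $ 3 * 0) (at 0)"
      by (intro tendsto_mult quot) auto
    moreover have "\<forall>\<^sub>F t in at 0. G t $ 3 / t * (\<beta> * s t * (1 - \<gamma> * s t) / (1 + \<alpha> * s t ^ 2)) = G t $ 2 / t"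
      using coords E
    proof eventually_elim
      case (elim t)
      have "G t $ 3 * (\<beta> * s t * (1 - \<gamma> * s t)) = G t $ 2 * (1 + \<alpha> * s t ^ 2)"
        using \<beta> by (simp add: elim(1) power2_eq_square power3_eq_cube)
      then have "G t $ 2 = G t $ 3 * (\<beta> * s t * (1 - \<gamma> * s t) / (1 + \<alpha> * s t ^ 2))"
        using elim(2) by (simp add: eq_divide_eq)
      then show ?case by simp
    qed
    ultimately have "((\<lambda>t. G t $ 2 / t) \<longlongrightarrow> v $ 3 * 0) (at 0)" by (rule Lim_transform_eventually)
    then show ?thesis using quot[of 2] tendsto_unique[OF trivial_limit_at] by fastforce
  qed
  have v1: "v $ 1 = 0"
  proof -
    have "((\<lambda>t. \<beta> * s t ^ 2 / (1 + \<alpha> * s t ^ 2)) \<longlongrightarrow> 0) (at 0)"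
      by (auto intro!: tendsto_eq_intros s)
    then have "((\<lambda>t. G t $ 3 / t * (\<beta> * s t ^ 2 / (1 + \<alpha> * s t ^ 2))) \<longlongrightarrow> v $ 3 * 0) (at 0)"
      by (intro tendsto_mult quot) auto
    moreover have "\<forall>\<^sub>F t in at 0. G t $ 3 / t * (\<beta> * s t ^ 2 / (1 + \<alpha> * s t ^ 2)) = G t $ 1 / t"
      using coords E
    proof eventually_elim
      case (elim t)
      have "G t $ 3 * (\<beta> * s t ^ 2) = G t $ 1 * (1 + \<alpha> * s t ^ 2)"
        using \<beta> by (simp add: elim(1) power2_eq_square power3_eq_cube)
      then have "G t $ 1 = G t $ 3 * (\<beta> * s t ^ 2 / (1 + \<alpha> * s t ^ 2))"
        using elim(2) by (simp add: eq_divide_eq)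
      then show ?case by simp
    qed
    ultimately have "((\<lambda>t. G t $ 1 / t) \<longlongrightarrow> v $ 3 * 0) (at 0)" by (rule Lim_transform_eventually)
    then show ?thesis using quot[of 1] tendsto_unique[OF trivial_limit_at] by fastforce
  qed
  have v3: "v $ 3 \<noteq> 0"
  proof
    assume "v $ 3 = 0"
    then have "v = (v $ 4 / l) *\<^sub>R G 0"
      using v1 v2 \<open>l \<noteq> 0\<close> by (simp add: vec_eq_iff forall_4 G0)
    then have "L (0, vector_derivative g (at 0)) = L ((v $ 4 / l) *\<^sub>R (1, g 0))"
      unfolding linear_scale[OF lin] by (simp add: v_def G_def)
    then have "(0 :: real, vector_derivative g (at 0)) = (v $ 4 / l) *\<^sub>R (1, g 0)" by (rule injD[OF inj])
    then have "vector_derivative g (at 0) = 0" by auto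
    with reg[of 0] e show False by simp
  qed
  have "(z has_real_derivative v $ 3 / l) (at 0)"
    unfolding z_def using deriv[of 3] deriv[of 4] \<open>l \<noteq> 0\<close>
    by (auto intro!: derivative_eq_intros simp: G0)
  then show z: "z \<in> \<Theta>[at 0](\<lambda>t. t)"
    by (rule bigtheta_if_derivative_nonzero) (use v3 \<open>l \<noteq> 0\<close> in \<open>simp_all add: z_def G0\<close>)
  have z0: "(z \<longlongrightarrow> 0) (at 0)"
    unfolding z_def using \<open>l \<noteq> 0\<close> by (auto intro!: tendsto_eq_intros limG simp: G0)
  have W_nz: "\<forall>\<^sub>F t in at 0. last_numerator \<alpha> \<beta> \<gamma> (s t) \<noteq> 0"
    using coords G4_nz by eventually_elim auto
  have "\<forall>\<^sub>F t in at 0. z t * last_numerator \<alpha> \<beta> \<gamma> (s t) = s t + \<alpha> * s t ^ 3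
      \<and> (G t $ 2 / G t $ 4) * (1 + \<alpha> * s t ^ 2) = \<beta> * z t * (s t - \<gamma> * s t ^ 2)
      \<and> (G t $ 1 / G t $ 4) * (1 + \<alpha> * s t ^ 2) = \<beta> * z t * s t ^ 2"
    using coords N_nz W_nz
  proof eventually_elim
    case (elim t)
    have eqs: "z t = s t * (1 + \<alpha> * s t ^ 2) / last_numerator \<alpha> \<beta> \<gamma> (s t)"
      "G t $ 2 / G t $ 4 = \<beta> * (s t ^ 2 * (1 - \<gamma> * s t)) / last_numerator \<alpha> \<beta> \<gamma> (s t)"
      "G t $ 1 / G t $ 4 = \<beta> * s t ^ 3 / last_numerator \<alpha> \<beta> \<gamma> (s t)"
      using \<beta> elim(2,3) by (simp_all add: z_def elim(1))
    show ?case unfolding eqs using elim(3) by (simp add: field_simps power2_eq_square power3_eq_cube)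
  qed
  then have rel: "\<forall>\<^sub>F t in at 0. z t * last_numerator \<alpha> \<beta> \<gamma> (s t) = s t + \<alpha> * s t ^ 3"
    "\<forall>\<^sub>F t in at 0. (G t $ 2 / G t $ 4) * (1 + \<alpha> * s t ^ 2) = \<beta> * z t * (s t - \<gamma> * s t ^ 2)"
    "\<forall>\<^sub>F t in at 0. (G t $ 1 / G t $ 4) * (1 + \<alpha> * s t ^ 2) = \<beta> * z t * s t ^ 2"
    by (auto elim!: eventually_mono)
  have "(\<lambda>t. z t ^ 5) \<in> O[at 0](\<lambda>t. t ^ 5)" using z by (intro landau_o.big_power) blast
  then show "(\<lambda>t. G t $ 2 / G t $ 4 - poly (jet_x1 \<alpha> \<beta> \<gamma>) (z t)) \<in> O[at 0](\<lambda>t. t ^ 5)"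
    and "(\<lambda>t. G t $ 1 / G t $ 4 - poly (jet_x0 \<alpha> \<beta> \<gamma>) (z t)) \<in> O[at 0](\<lambda>t. t ^ 5)"
    using jet_expansion[OF s z0 rel] landau_o.big_trans by blast+
qed

text \<open>
  The chart \<open>x\<^sub>3 = 1\<close>, in which \<open>U\<close> is the origin.
\<close>

definition std_chart :: "real \<times> (real^3) \<Rightarrow> real^4" where
  "std_chart p = vector [snd p $ 1, snd p $ 2, snd p $ 3, fst p]"

lemma affine_chart_std_chart: "affine_chart std_chart"
  unfolding affine_chart_def
proof
  show "linear std_chart"
    by (rule linearI) (simp_all add: std_chart_def vec_eq_iff forall_4)
  show "bij std_chart"
  proof (rule o_bij)
    let ?inv = "\<lambda>x :: real^4. (x $ 4, vector [x $ 1, x $ 2, x $ 3] :: real^3)"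
    show "?inv \<circ> std_chart = id" by (auto simp: fun_eq_iff std_chart_def vec_eq_iff forall_3)
    show "std_chart \<circ> ?inv = id" by (auto simp: fun_eq_iff std_chart_def vec_eq_iff forall_4)
  qed
qed

lemma dvd_pcompose_diff: "a - b dvd pcompose p a - pcompose p b" for a b p :: "'a::idom poly"
proof (induction p)
  case (pCons c p)
  have "pcompose (pCons c p) a - pcompose (pCons c p) b
      = (a - b) * pcompose p a + b * (pcompose p a - pcompose p b)"
    by (simp add: pcompose_pCons algebra_simps)
  then show ?case using pCons.IH by (metis dvd_add dvd_mult dvd_triv_left)
qed simp

text \<open>
  Modulo \<open>X^(n+1)\<close> the equation \<open>p = X w(p) - a p^3\<close> is solved by iteration: when \<open>p\<close> and \<open>q\<close>
  vanish at \<open>0\<close> and agree modulo \<open>X^n\<close>, their right-hand sides agree modulo \<open>X^(n+1)\<close>, thanks to the factor \<open>X\<close> in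
  the first term and because \<open>X\<close> divides \<open>q^2 + qp + p^2\<close>.
  For the cubic \<open>w\<close> of the curve this equation says that \<open>z = t\<close> at \<open>s = p(t)\<close>, so a truncated inverse of
  \<open>s \<mapsto> z\<close> is obtained as a polynomial.
\<close>

lemma approximate_fixed_point:
  fixes w :: "real poly"
  defines "X \<equiv> [:0, 1:]"
  shows "\<exists>p. X dvd p \<and> X ^ Suc n dvd X * pcompose w p - smult a (p ^ 3) - p"
proof (induction n)
  case 0
  have "X ^ Suc 0 dvd X * pcompose w 0 - smult a (0 ^ 3) - 0"
    unfolding power_Suc power_0 mult_1_right by (intro dvd_diff dvd_smult dvd_triv_left) simp_all
  then show ?case by (intro exI[of _ 0]) simp
next
  case (Suc n)
  define T where "T p = X * pcompose w p - smult a (p ^ 3)" for p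
  obtain p where p: "X dvd p" "X ^ Suc n dvd T p - p" using Suc unfolding T_def by blast
  have "X dvd p ^ 3" using p(1) dvd_power[of 3 p] by (rule dvd_trans) simp
  then have X_T: "X dvd T p" unfolding T_def by (intro dvd_diff dvd_smult dvd_triv_left)
  have diff: "T q - T p = X * (pcompose w q - pcompose w p) - smult a ((q - p) * (q * q + q * p + p * p))" for q
  proof -
    have cube: "q ^ 3 = p ^ 3 + (q - p) * (q * q + q * p + p * p)" by (simp add: algebra_simps power3_eq_cube)
    show ?thesis unfolding T_def cube by (simp add: right_diff_distrib smult_add_right)
  qed
  have "X ^ Suc (Suc n) dvd X * (pcompose w (T p) - pcompose w p)"
    unfolding power_Suc[of X "Suc n"] using p(2) dvd_pcompose_diff by (intro mult_dvd_mono dvd_refl) (rule dvd_trans)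
  moreover have "X ^ Suc (Suc n) dvd (T p - p) * (T p * T p + T p * p + p * p)"
    unfolding power_Suc2[of X "Suc n"] using p X_T by (intro mult_dvd_mono dvd_add dvd_mult)
  ultimately have "X ^ Suc (Suc n) dvd T (T p) - T p"
    unfolding diff by (intro dvd_diff dvd_smult)
  with X_T show ?case unfolding T_def[of "T p"] by blast
qed

text \<open>
  The parametrization is \<open>t \<mapsto> \<Phi>(\<sigma>(t), 1)\<close> with \<open>\<sigma>\<close> a polynomial from \<open>approximate_fixed_point\<close>. It is a
  rational curve, hence smooth, and \<open>z = t + O(t^5)\<close> has derivative \<open>1\<close> at \<open>0\<close>, so it is a regular and injective
  curve near \<open>0\<close>. Since \<open>s\<close> is a continuous function \<open>q\<close> of the point, the image of the parameter
  interval \<open>I\<close> is cut out of the curve by the open condition \<open>q \<in> \<sigma>(I)\<close>, and the inverse of the parametrization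
  is \<open>q\<close> followed by the inverse of \<open>\<sigma>\<close>.
\<close>

lemma exists_regular_local_param_at_U:
  assumes \<beta>: "\<beta> \<noteq> 0" "\<beta> \<noteq> 3"
  shows "\<exists>g. regular_local_param std_chart (cubic_parabola \<alpha> \<beta> \<gamma>) point_U g
     \<and> (\<lambda>t. g t $ 3 - t) \<in> O[at 0](\<lambda>t. t ^ 5)"
proof -
  define w where "w = [:(3 - \<beta>) / 3, \<gamma> * (\<beta> - 1), \<alpha> - \<beta> * \<gamma>^2, - (\<gamma> * (3 * \<alpha> - \<beta> * \<gamma>^2) / 3):]"
  have w: "poly w x = last_numerator \<alpha> \<beta> \<gamma> x" for x
    by (simp add: w_def last_numerator_def algebra_simps power2_eq_square power3_eq_cube)
  obtain p where p0: "[:0, 1:] dvd p"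
    and p: "[:0, 1:] ^ 5 dvd [:0, 1:] * pcompose w p - smult \<alpha> (p ^ 3) - p"
    using approximate_fixed_point[of 4 w \<alpha>] by (auto simp: eval_nat_numeral)
  define \<sigma> where "\<sigma> t = poly p t" for t
  have \<sigma>0: "\<sigma> 0 = 0" using p0 by (auto simp: \<sigma>_def)
  have cont_\<sigma>: "continuous_on S \<sigma>" for S unfolding \<sigma>_def by (intro continuous_intros)
  define D where "D t = last_numerator \<alpha> \<beta> \<gamma> (\<sigma> t)" for t
  have D_poly: "D t = poly (pcompose w p) t" for t by (simp add: D_def \<sigma>_def w poly_pcompose)
  have cont_D: "continuous_on S D" for S unfolding D_poly by (intro continuous_intros)
  have D0: "D 0 \<noteq> 0" using \<beta> by (simp add: D_def \<sigma>0 last_numerator_def)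
  define g :: "real \<Rightarrow> real^3" where
    "g t = vector [\<beta> * \<sigma> t ^ 3, \<beta> * (\<sigma> t ^ 2 * (1 - \<gamma> * \<sigma> t)), \<sigma> t + \<alpha> * \<sigma> t ^ 3] /\<^sub>R D t" for t
  have g3: "g t $ 3 = (\<sigma> t + \<alpha> * \<sigma> t ^ 3) / D t" for t by (simp add: g_def field_simps)

  have z_t: "(\<lambda>t. g t $ 3 - t) \<in> O[at 0](\<lambda>t. t ^ 5)"
  proof -
    obtain r where r: "[:0, 1:] * pcompose w p - smult \<alpha> (p ^ 3) - p = [:0, 1:] ^ 5 * r" using p by (elim dvdE)
    have r': "t * D t - \<alpha> * \<sigma> t ^ 3 - \<sigma> t = t ^ 5 * poly r t" for t
      using arg_cong[OF r, of "\<lambda>q. poly q t"] by (simp add: D_poly \<sigma>_def)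
    have "\<forall>\<^sub>F t in at 0. D t \<noteq> 0"
      using cont_D[of UNIV] D0 by (intro tendsto_imp_eventually_ne[where c = "D 0"]) (auto simp: continuous_on_def)
    then have "\<forall>\<^sub>F t in at 0. t ^ 5 * (- poly r t / D t) = g t $ 3 - t"
    proof eventually_elim
      case (elim t)
      have "- (t ^ 5 * poly r t) = \<sigma> t + \<alpha> * \<sigma> t ^ 3 - t * D t" using r'[of t] by simp
      with elim show ?case unfolding g3 by (simp add: field_simps)
    qed
    moreover have "(\<lambda>t. - poly r t / D t) \<in> O[at 0](\<lambda>_. 1)"
    proof (rule bigoI_tendsto)
      show "((\<lambda>t. - poly r t / D t / 1) \<longlongrightarrow> - poly r 0 / D 0) (at 0)"
        unfolding D_poly using D0 by (auto intro!: tendsto_eq_intros simp: D_poly)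
    qed simp
    then have "(\<lambda>t. t ^ 5 * (- poly r t / D t)) \<in> O[at 0](\<lambda>t. t ^ 5)"
      using landau_o.big.mult_left[of "\<lambda>t. - poly r t / D t" "at 0" "\<lambda>_. 1" "\<lambda>t. t ^ 5"]
      by (simp only: mult_1_right)
    ultimately show ?thesis using landau_o.big.in_cong by fast
  qed

  define I0 where "I0 = {t. D t \<noteq> 0}"
  have I0: "open I0" "0 \<in> I0"
    unfolding I0_def using D0 by (auto intro!: open_Collect_neq cont_D)
  have smooth: "smooth_on I0 g"
  proof -
    define P :: "real poly ^ 3" where
      "P = vector [smult \<beta> (p ^ 3), smult \<beta> (p ^ 2 * (1 - smult \<gamma> p)), p + smult \<alpha> (p ^ 3)]"
    have "g = (\<lambda>t. \<chi> i. poly (P $ i) t / poly (pcompose w p) t)"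
      by (simp add: fun_eq_iff g_def P_def vec_eq_iff forall_3 \<sigma>_def D_poly divide_inverse mult.commute)
    moreover have "smooth_on I0 (\<lambda>t. \<chi> i. poly (P $ i) t / poly (pcompose w p) t)"
      using I0(1) by (rule smooth_on_rational_curve) (simp add: I0_def flip: D_poly)
    ultimately show ?thesis by simp
  qed
  have deriv_g: "(g has_vector_derivative iter_vderiv 1 g t) (at t)" if "t \<in> I0" for t
    using has_vector_derivative_iter_vderiv[OF smooth that, of 0] by (simp add: iter_vderiv_def)
  then have deriv_z: "((\<lambda>t. g t $ 3) has_real_derivative iter_vderiv 1 g t $ 3) (at t)" if "t \<in> I0" for t
    using that unfolding has_vector_derivative_vec_iff by blast

  (* As only \<open>z = t + O(t^5)\<close> is known explicitly, the derivative is computed as a limit of difference quotients. *)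
  have z'0: "iter_vderiv 1 g 0 $ 3 = 1"
  proof -
    have "(\<lambda>t. g t $ 3 - t) \<in> o[at 0](\<lambda>t. t)"
    proof (rule landau_o.big_small_trans[OF z_t])
      show "(\<lambda>t. t ^ 5) \<in> o[at 0](\<lambda>t. t :: real)"
        using poly_smallo_power_iff[of "\<lambda>t. t" "monom 1 5" 1] by (simp add: poly_monom)
    qed
    then have "((\<lambda>t. (g t $ 3 - t) / t) \<longlongrightarrow> 0) (at 0)" by (rule smalloD_tendsto)
    then have "((\<lambda>t. (g t $ 3 - t) / t + 1) \<longlongrightarrow> 0 + 1) (at 0)" by (intro tendsto_intros)
    moreover have "\<forall>\<^sub>F t in at 0. (g t $ 3 - t) / t + 1 = (g t $ 3 - g 0 $ 3) / t"
      by (simp add: eventually_at_filter g3 \<sigma>0 field_simps)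
    ultimately have "((\<lambda>t. (g t $ 3 - g 0 $ 3) / t) \<longlongrightarrow> 1) (at 0)"
      using Lim_transform_eventually by fastforce
    then have "((\<lambda>t. g t $ 3) has_real_derivative 1) (at 0)" by (simp add: DERIV_def)
    with deriv_z[OF I0(2)] show ?thesis by (rule DERIV_unique)
  qed
  have "isCont (\<lambda>t. iter_vderiv 1 g t $ 3) 0"
    using has_vector_derivative_iter_vderiv[OF smooth I0(2), of 1]
    by (intro isCont_vec_nth has_vector_derivative_continuous)
  then have "\<forall>\<^sub>F t in at 0. iter_vderiv 1 g t $ 3 > 0"
    unfolding isCont_def by (rule order_tendstoD) (use z'0 in simp)
  then have "\<forall>\<^sub>F t in nhds 0. iter_vderiv 1 g t $ 3 > 0 \<and> t \<in> I0"
    using z'0 I0(2) eventually_at_in_open'[OF I0] by (auto simp: eventually_nhds_conv_at eventually_conj_iff)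
  then obtain e where e: "e > 0" "\<And>t. dist t 0 < e \<Longrightarrow> iter_vderiv 1 g t $ 3 > 0 \<and> t \<in> I0"
    unfolding eventually_nhds_metric by blast
  define I where "I = {-e<..<e}"
  have I: "I \<subseteq> I0" "\<And>t. t \<in> I \<Longrightarrow> iter_vderiv 1 g t $ 3 > 0" using e(2) by (auto simp: I_def dist_norm)
  have z_less: "g a $ 3 < g b $ 3" if "a \<in> I" "b \<in> I" "a < b" for a b
  proof (rule DERIV_pos_imp_increasing[OF that(3)])
    fix t assume "a \<le> t" "t \<le> b"
    then have "t \<in> I" using that by (auto simp: I_def)
    then show "\<exists>y. ((\<lambda>t. g t $ 3) has_real_derivative y) (at t) \<and> 0 < y" using deriv_z I by blast
  qed
  have inj: "inj_on \<sigma> I"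
  proof (rule inj_onI)
    fix a b assume "a \<in> I" "b \<in> I" "\<sigma> a = \<sigma> b"
    then show "a = b" using z_less[of a b] z_less[of b a] by (cases a b rule: linorder_cases) (auto simp: g3 D_def)
  qed
  have "open I" by (simp add: I_def)
  obtain \<tau> where \<tau>: "homeomorphism I (\<sigma> ` I) \<sigma> \<tau>"
    using invariance_of_domain_homeomorphism[OF \<open>open I\<close> cont_\<sigma> _ inj] by auto
  have open_\<sigma>: "open (\<sigma> ` I)" by (rule invariance_of_domain[OF cont_\<sigma> \<open>open I\<close> inj])

  define N where "N y = form_u1_cube \<alpha> \<beta> \<gamma> (std_chart (1, y))" for y
  define q where "q y = form_u0_u1_sq \<alpha> \<beta> (std_chart (1, y)) / N y" for y
  define V where "V = {y. N y \<noteq> 0}"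
  have cont_N: "continuous_on S N" for S
    unfolding N_def form_u1_cube_def form_u0_u1_sq_def std_chart_def using \<beta> by (auto intro!: continuous_intros)
  have open_V: "open V" unfolding V_def by (intro open_Collect_neq cont_N continuous_intros)
  have cont_q: "continuous_on V q"
    unfolding q_def form_u0_u1_sq_def std_chart_def by (auto intro!: continuous_intros cont_N simp: V_def)

  have g_Phi: "std_chart (1, g t) = (\<beta> / D t) *\<^sub>R Phi \<alpha> \<beta> \<gamma> (vector [\<sigma> t, 1])" if "D t \<noteq> 0" for t
  proof -
    have Phi4: "Phi \<alpha> \<beta> \<gamma> (vector [\<sigma> t, 1]) $ 4 = D t / \<beta>" using \<beta> by (simp add: Phi_last_coordinate D_def)
    have Phi123: "Phi \<alpha> \<beta> \<gamma> (vector [\<sigma> t, 1]) $ 1 = \<sigma> t ^ 3"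
      "Phi \<alpha> \<beta> \<gamma> (vector [\<sigma> t, 1]) $ 2 = \<sigma> t ^ 2 * (1 - \<gamma> * \<sigma> t)"
      "Phi \<alpha> \<beta> \<gamma> (vector [\<sigma> t, 1]) $ 3 = \<sigma> t * (1 + \<alpha> * \<sigma> t ^ 2) / \<beta>"
      by (simp_all add: Phi_def)
    show ?thesis using \<beta> that
      by (simp add: vec_eq_iff forall_4 std_chart_def g_def Phi123 Phi4) (simp add: field_simps power2_eq_square power3_eq_cube)
  qed
  have N_g: "N (g t) = \<beta> / D t" and q_g: "q (g t) = \<sigma> t" if "D t \<noteq> 0" for t
    using that \<beta> by (simp_all add: N_def q_def g_Phi[OF that] forms_scaleR forms_Phi)
  have D_I: "D t \<noteq> 0" if "t \<in> I" for t using that I(1) by (auto simp: I0_def)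
  have image: "g ` I = in_chart std_chart (cubic_parabola \<alpha> \<beta> \<gamma>) \<inter> (V \<inter> q -` (\<sigma> ` I))" (is "_ = ?R")
  proof (intro equalityI subsetI)
    fix y assume "y \<in> g ` I"
    then obtain t where t: "t \<in> I" "y = g t" by blast
    have "vector [\<sigma> t, 1] \<noteq> (0 :: real^2)" by (simp add: vec_eq_iff forall_2)
    moreover have "span {std_chart (1, g t)} = span {Phi \<alpha> \<beta> \<gamma> (vector [\<sigma> t, 1])}"
      using span_image_scale[of "{Phi \<alpha> \<beta> \<gamma> (vector [\<sigma> t, 1])}" "\<lambda>_. \<beta> / D t"] \<beta> D_I[OF t(1)]
      by (simp add: g_Phi)
    ultimately have "y \<in> in_chart std_chart (cubic_parabola \<alpha> \<beta> \<gamma>)"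
      unfolding in_chart_def cubic_parabola_def t(2) by blast
    then show "y \<in> ?R" using t D_I[OF t(1)] \<beta> by (simp add: V_def N_g q_g)
  next
    fix y assume y: "y \<in> ?R"
    then obtain t where t: "t \<in> I" "q y = \<sigma> t" by auto
    have "std_chart (1, y) = N y *\<^sub>R Phi \<alpha> \<beta> \<gamma> (vector [q y, 1])"
      unfolding N_def q_def
      by (rule cubic_parabola_eq_Phi[OF \<beta>]) (use y in \<open>auto simp: in_chart_def V_def N_def\<close>)
    then have *: "std_chart (1, y) = N y *\<^sub>R Phi \<alpha> \<beta> \<gamma> (vector [\<sigma> t, 1])" by (simp add: t)
    have "std_chart (1, y) $ 4 = 1" by (simp add: std_chart_def)
    then have "1 = N y * (D t / \<beta>)" unfolding * by (simp add: Phi_last_coordinate[OF \<beta>(1)] D_def)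
    then have "N y = \<beta> / D t" using \<beta> D_I[OF t(1)] by (simp add: field_simps)
    then have "std_chart (1, y) = std_chart (1, g t)" using * g_Phi[OF D_I[OF t(1)]] by simp
    then have "y = g t" using affine_chart_std_chart by (auto simp: affine_chart_def bij_def dest: injD)
    with t(1) show "y \<in> g ` I" by blast
  qed

  have "regular_local_param std_chart (cubic_parabola \<alpha> \<beta> \<gamma>) point_U g"
    unfolding regular_local_param_def Let_def
  proof (intro conjI exI[of _ e])
    show "span {std_chart (1, g 0)} = point_U"
    proof -
      have "std_chart (1, g 0) = vector [0, 0, 0, 1]"
        by (simp add: std_chart_def g_def \<sigma>0 vec_eq_iff forall_4)
      then show ?thesis by (simp add: point_U_def)
    qed
    show "e > 0" by fact
    show "smooth_on {-e<..<e} g" using smooth I(1) unfolding smooth_on_def I_def by blast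
    show "\<forall>t\<in>{-e<..<e}. vector_derivative g (at t) \<noteq> 0"
    proof
      fix t assume "t \<in> {-e<..<e}"
      then have "iter_vderiv 1 g t $ 3 > 0" using I(2) by (simp add: I_def)
      then show "vector_derivative g (at t) \<noteq> 0" by (auto simp: iter_vderiv_def)
    qed
    have "open (V \<inter> q -` (\<sigma> ` I))" using cont_q open_V open_\<sigma> by (rule continuous_open_preimage)
    then show "openin (top_of_set (in_chart std_chart (cubic_parabola \<alpha> \<beta> \<gamma>))) (g ` {-e<..<e})"
      unfolding image[unfolded I_def] using I_def openin_open by auto
    have "continuous_on I g"
    proof (intro continuous_at_imp_continuous_on ballI)
      fix t assume "t \<in> I"
      then show "isCont g t" using deriv_g I(1) has_vector_derivative_continuous by blast
    qed
    moreover have "continuous_on (g ` I) (\<tau> \<circ> q)"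
    proof (rule continuous_on_compose)
      show "continuous_on (g ` I) q" using cont_q by (rule continuous_on_subset) (use image in auto)
      have "q ` g ` I = \<sigma> ` I" using q_g D_I by (auto simp: image_image)
      then show "continuous_on (q ` g ` I) \<tau>" using \<tau> by (simp add: homeomorphism_def)
    qed
    moreover have "(\<tau> \<circ> q) (g t) = t" if "t \<in> I" for t
      using that \<tau> q_g[OF D_I] by (simp add: homeomorphism_def)
    ultimately have "homeomorphism I (g ` I) g (\<tau> \<circ> q)" unfolding homeomorphism_def by (auto simp: image_image)
    then show "\<exists>h. homeomorphism {-e<..<e} (g ` {-e<..<e}) g h" unfolding I_def by blast
  qed
  with z_t show ?thesis by blast
qed

section \<open>Contact at U in terms of the expansions\<close>

lemma smallo_quotient_diff:
  fixes A B a b :: "real \<Rightarrow> real"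
  assumes "(\<lambda>t. A t - B t) \<in> o[F](w)" "(\<lambda>t. a t - b t) \<in> o[F](w)"
    and B: "(B \<longlongrightarrow> L) F" and a: "(a \<longlongrightarrow> l) F" "l \<noteq> 0" and b: "(b \<longlongrightarrow> l') F" "l' \<noteq> 0"
  shows "(\<lambda>t. A t / a t - B t / b t) \<in> o[F](w)"
proof -
  have nz: "\<forall>\<^sub>F t in F. a t \<noteq> 0" "\<forall>\<^sub>F t in F. b t \<noteq> 0"
    using a b by (auto intro: tendsto_imp_eventually_ne)
  have "(\<lambda>t. 1 / a t) \<in> O[F](\<lambda>_. 1)"
    by (rule bigoI_tendsto[of _ _ "1 / l"]) (use a in \<open>auto intro!: tendsto_eq_intros\<close>)
  moreover have "(\<lambda>t. B t / (a t * b t)) \<in> O[F](\<lambda>_. 1)"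
    by (rule bigoI_tendsto[of _ _ "L / (l * l')"]) (use a b B in \<open>auto intro!: tendsto_eq_intros\<close>)
  ultimately have "(\<lambda>t. 1 / a t * (A t - B t) - B t / (a t * b t) * (a t - b t)) \<in> o[F](w)"
    using assms(1,2) landau_o.big_small_mult[of _ F "\<lambda>_. 1" _ w] by (intro sum_in_smallo) fastforce+
  moreover have "\<forall>\<^sub>F t in F. 1 / a t * (A t - B t) - B t / (a t * b t) * (a t - b t) = A t / a t - B t / b t"
    using nz by eventually_elim (simp add: field_simps)
  ultimately show ?thesis using landau_o.small.in_cong by fast
qed

lemma smallo_chart_diff:
  fixes L :: "real \<times> (real^3) \<Rightarrow> real^4" and g h :: "real \<Rightarrow> real^3"
  assumes "linear L" and gh: "\<And>j. (\<lambda>t. g t $ j - h t $ j) \<in> o[F](w)"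
  shows "(\<lambda>t. L (1, g t) $ i - L (1, h t) $ i) \<in> o[F](w)"
proof -
  have "L (1, g t) $ i - L (1, h t) $ i = (\<Sum>j\<in>UNIV. L (0, axis j 1) $ i * (g t $ j - h t $ j))" for t
  proof -
    have "(1, g t) - (1, h t) = (\<Sum>j\<in>UNIV. (g t $ j - h t $ j) *\<^sub>R (0 :: real, axis j 1 :: real^3))"
      using basis_expansion[of "g t - h t"] by (simp add: prod_eq_iff fst_sum snd_sum scalar_mult_eq_scaleR)
    then have "L (1, g t) - L (1, h t) = (\<Sum>j\<in>UNIV. (g t $ j - h t $ j) *\<^sub>R L (0, axis j 1))"
      by (simp only: linear_sum[OF assms(1)] linear_scale[OF assms(1)] linear_diff[OF assms(1), symmetric])
    then have "(L (1, g t) - L (1, h t)) $ i = (\<Sum>j\<in>UNIV. (g t $ j - h t $ j) *\<^sub>R L (0, axis j 1)) $ i" by simp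
    then show ?thesis by (simp add: sum_component mult.commute)
  qed
  then show ?thesis using gh by (auto intro!: big_sum_in_smallo)
qed

text \<open>
  The bound \<open>k \<le> 4\<close> is the order to which the expansions are known.
\<close>

lemma contact_iff_jets_eq:
  assumes \<beta>: "\<beta> \<noteq> 0" "\<beta> \<noteq> 3" and \<beta>': "\<beta>' \<noteq> 0" "\<beta>' \<noteq> 3" and k: "k \<le> 4"
  shows "contact k (cubic_parabola \<alpha> \<beta> \<gamma>) (cubic_parabola \<alpha>' \<beta>' \<gamma>') point_U
    \<longleftrightarrow> (\<forall>i\<le>k. coeff (jet_x1 \<alpha> \<beta> \<gamma>) i = coeff (jet_x1 \<alpha>' \<beta>' \<gamma>') i
             \<and> coeff (jet_x0 \<alpha> \<beta> \<gamma>) i = coeff (jet_x0 \<alpha>' \<beta>' \<gamma>') i)"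
    (is "?contact \<longleftrightarrow> ?jets")
proof -
  let ?C = "cubic_parabola \<alpha> \<beta> \<gamma>" and ?C' = "cubic_parabola \<alpha>' \<beta>' \<gamma>'"
  have small: "(\<lambda>t. t ^ 5) \<in> o[at 0](\<lambda>t. t ^ k :: real)"
    using poly_smallo_power_iff[of "\<lambda>t. t" "monom 1 5" k] k by (simp add: poly_monom)
  have taylor: "(\<forall>i\<le>k. taylor_coeff g i = taylor_coeff h i) \<longleftrightarrow> (\<forall>j. (\<lambda>t. g t $ j - h t $ j) \<in> o[at 0](\<lambda>t. t ^ k))"
    if params: "regular_local_param L ?C point_U g" "regular_local_param L ?C' point_U h" for L g h
  proof -
    obtain d where "d > 0" "smooth_on {-d<..<d} g"
      using params(1) unfolding regular_local_param_def Let_def by blast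
    moreover obtain e where "e > 0" "smooth_on {-e<..<e} h"
      using params(2) unfolding regular_local_param_def Let_def by blast
    ultimately show ?thesis
      by (intro taylor_coeffs_eq_iff_smallo[of "{-d<..<d}" _ "{-e<..<e}"]) auto
  qed
  have jets: "((\<lambda>t. L (1, g t) $ 2 / L (1, g t) $ 4 - L (1, h t) $ 2 / L (1, h t) $ 4) \<in> o[at 0](\<lambda>t. t ^ k)
      \<and> (\<lambda>t. L (1, g t) $ 1 / L (1, g t) $ 4 - L (1, h t) $ 1 / L (1, h t) $ 4) \<in> o[at 0](\<lambda>t. t ^ k)) \<longleftrightarrow> ?jets"
    if L: "affine_chart L" and g: "regular_local_param L ?C point_U g" and h: "regular_local_param L ?C' point_U h"
      and z: "(\<lambda>t. L (1, g t) $ 3 / L (1, g t) $ 4 - L (1, h t) $ 3 / L (1, h t) $ 4) \<in> o[at 0](\<lambda>t. t ^ k)" for L g h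
    using smallo_diff_iff_coeff_eq[OF regular_local_param_at_U(3)[OF \<beta> L g] regular_local_param_at_U(3)[OF \<beta>' L h] z
        regular_local_param_at_U(4)[OF \<beta> L g, THEN landau_o.big_small_trans[OF _ small]]
        regular_local_param_at_U(4)[OF \<beta>' L h, THEN landau_o.big_small_trans[OF _ small]]]
      smallo_diff_iff_coeff_eq[OF regular_local_param_at_U(3)[OF \<beta> L g] regular_local_param_at_U(3)[OF \<beta>' L h] z
        regular_local_param_at_U(5)[OF \<beta> L g, THEN landau_o.big_small_trans[OF _ small]]
        regular_local_param_at_U(5)[OF \<beta>' L h, THEN landau_o.big_small_trans[OF _ small]]]
    by blast
  show ?thesis
  proof
    assume ?contact
    then obtain L g h where L: "affine_chart L" and g: "regular_local_param L ?C point_U g"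
      and h: "regular_local_param L ?C' point_U h" and eq: "\<forall>i\<le>k. taylor_coeff g i = taylor_coeff h i"
      unfolding contact_def by blast
    have "linear L" using L by (simp add: affine_chart_def)
    then have diff: "(\<lambda>t. L (1, g t) $ i - L (1, h t) $ i) \<in> o[at 0](\<lambda>t. t ^ k)" for i
      using taylor[OF g h] eq by (intro smallo_chart_diff) auto
    have lim: "((\<lambda>t. L (1, g t) $ i) \<longlongrightarrow> L (1, g 0) $ i) (at 0)"
      "((\<lambda>t. L (1, h t) $ i) \<longlongrightarrow> L (1, h 0) $ i) (at 0)" for i
      using regular_local_param_at_U(1)[OF \<beta> L g] regular_local_param_at_U(1)[OF \<beta>' L h]
      by (auto intro!: tendsto_vec_nth simp: isCont_def)
    have "(\<lambda>t. L (1, g t) $ i / L (1, g t) $ 4 - L (1, h t) $ i / L (1, h t) $ 4) \<in> o[at 0](\<lambda>t. t ^ k)" for i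
      using diff diff lim(2) lim(1) regular_local_param_at_U(2)[OF \<beta> L g] lim(2) regular_local_param_at_U(2)[OF \<beta>' L h]
      by (rule smallo_quotient_diff)
    with jets[OF L g h] show ?jets by blast
  next
    assume ?jets
    obtain g where g: "regular_local_param std_chart ?C point_U g" "(\<lambda>t. g t $ 3 - t) \<in> O[at 0](\<lambda>t. t ^ 5)"
      using exists_regular_local_param_at_U[OF \<beta>] by blast
    obtain h where h: "regular_local_param std_chart ?C' point_U h" "(\<lambda>t. h t $ 3 - t) \<in> O[at 0](\<lambda>t. t ^ 5)"
      using exists_regular_local_param_at_U[OF \<beta>'] by blast
    have "(\<lambda>t. (g t $ 3 - t) - (h t $ 3 - t)) \<in> O[at 0](\<lambda>t. t ^ 5)" using g(2) h(2) by (rule sum_in_bigo)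
    then have z: "(\<lambda>t. g t $ 3 - h t $ 3) \<in> o[at 0](\<lambda>t. t ^ k)"
      using landau_o.big_small_trans[OF _ small] by simp
    have "(\<lambda>t. g t $ j - h t $ j) \<in> o[at 0](\<lambda>t. t ^ k)" for j
      using jets[OF affine_chart_std_chart g(1) h(1)] z \<open>?jets\<close> exhaust_3[of j] by (auto simp: std_chart_def)
    then have "\<forall>i\<le>k. taylor_coeff g i = taylor_coeff h i" using taylor[OF g(1) h(1)] by blast
    then show ?contact unfolding contact_def using affine_chart_std_chart g(1) h(1) by blast
  qed
qed

theorem theorem1:
  fixes \<alpha> \<beta> \<gamma> \<alpha>' \<beta>' \<gamma>' :: real
  assumes "\<beta> \<notin> {0, 3}" and "\<beta>' \<notin> {0, 3}"
    and "cubic_parabola \<alpha> \<beta> \<gamma> \<noteq> cubic_parabola \<alpha>' \<beta>' \<gamma>'"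
  shows
    "(contact 2 (cubic_parabola \<alpha> \<beta> \<gamma>) (cubic_parabola \<alpha>' \<beta>' \<gamma>') point_U
        \<longleftrightarrow> \<beta> = \<beta>' \<or> \<beta> = 3 - \<beta>') \<and>
     (contact 3 (cubic_parabola \<alpha> \<beta> \<gamma>) (cubic_parabola \<alpha>' \<beta>' \<gamma>') point_U
        \<longleftrightarrow> (\<beta> = \<beta>' \<and> \<gamma> = \<gamma>') \<or> (\<beta> = \<beta>' \<and> \<beta>' = 3 / 2)) \<and>
     (contact 4 (cubic_parabola \<alpha> \<beta> \<gamma>) (cubic_parabola \<alpha>' \<beta>' \<gamma>') point_U
        \<longleftrightarrow> \<beta> = \<beta>' \<and> \<beta>' = 3 / 2 \<and> \<gamma> = \<gamma>')"
proof -
  have \<beta>: "\<beta> \<noteq> 0" "\<beta> \<noteq> 3" "\<beta>' \<noteq> 0" "\<beta>' \<noteq> 3" using assms(1,2) by auto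
  have "(\<beta> = \<beta>' \<and> \<gamma> = \<gamma>' \<and> (\<alpha> = \<alpha>' \<or> \<beta>' = 3 / 2)) \<longleftrightarrow> \<beta> = \<beta>' \<and> \<beta>' = 3 / 2 \<and> \<gamma> = \<gamma>'"
    using assms(3) by auto
  then show ?thesis
    using contact_iff_jets_eq[OF \<beta>, of 2 \<alpha> \<gamma> \<alpha>' \<gamma>'] contact_iff_jets_eq[OF \<beta>, of 3 \<alpha> \<gamma> \<alpha>' \<gamma>']
      contact_iff_jets_eq[OF \<beta>, of 4 \<alpha> \<gamma> \<alpha>' \<gamma>'] jets_eq_iff[OF assms(1,2), of \<alpha> \<gamma> \<alpha>' \<gamma>']
    by auto
qed

end
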